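(* If $G$ and $H$ are polynomially bounded knapsack groups, then the free product $G*H$ is a polynomially bounded knapsack group.
   Context: Groups are finitely generated; for a group $K$ with finite generating set $X$, elements are given as words over $X\cup X^{-1}$, and none of the notions below depends on the choice of finite $X$. $\mathbf{KP}(K)$ (knapsack problem): given $g_1,\dots,g_k,g\in K$, decide whether $g=g_1^{\varepsilon_1}\cdots g_k^{\varepsilon_k}$ for some non-negative integers $\varepsilon_1,\dots,\varepsilon_k$. $\mathbf{BKP}(K)$ (bounded knapsack problem): given $g_1,\dots,g_k,g\in K$ and a positive integer $m$, decide whether $g=g_1^{\varepsilon_1}\cdots g_k^{\varepsilon_k}$ for some integers $0\le\varepsilon_j\le m$. $K$ is a polynomially bounded knapsack group if there is a polynomial $q$ such that any instance $(g_1,\dots,g_k,g)$ of $\mathbf{KP}(K)$ is positive if and only if the instance $(g_1,\dots,g_k,g,q(N))$ of $\mathbf{BKP}(K)$ is positive, where $N$ is the total length (sum of the word lengths) of $g_1,\dots,g_k,g$. *)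

theory Defs
  imports "HOL-Algebra.Generated_Groups" "HOL-Computational_Algebra.Polynomial"
begin

section \<open>Words and knapsack problems\<close>

definition finite_gen_set :: "('a, 'm) monoid_scheme \<Rightarrow> 'a set \<Rightarrow> bool" where
  "finite_gen_set K X \<longleftrightarrow> finite X \<and> X \<subseteq> carrier K \<and> generate K X = carrier K"

definition group_words :: "('a, 'm) monoid_scheme \<Rightarrow> 'a set \<Rightarrow> 'a list set" where
  "group_words K X = lists (X \<union> m_inv K ` X)"

definition list_mult :: "('a, 'm) monoid_scheme \<Rightarrow> 'a list \<Rightarrow> 'a" where
  "list_mult K xs = foldr (\<otimes>\<^bsub>K\<^esub>) xs \<one>\<^bsub>K\<^esub>"

definition knapsack_prod :: "('a, 'm) monoid_scheme \<Rightarrow> 'a list \<Rightarrow> nat list \<Rightarrow> 'a" where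
  "knapsack_prod K gs es = list_mult K (map2 (\<lambda>g e. g [^]\<^bsub>K\<^esub> e) gs es)"

text \<open>Positive instances of the knapsack problem and of its bounded version.\<close>

definition KP :: "('a, 'm) monoid_scheme \<Rightarrow> 'a list \<Rightarrow> 'a \<Rightarrow> bool" where
  "KP K gs g \<longleftrightarrow> (\<exists>es. length es = length gs \<and> g = knapsack_prod K gs es)"

definition BKP :: "('a, 'm) monoid_scheme \<Rightarrow> 'a list \<Rightarrow> 'a \<Rightarrow> nat \<Rightarrow> bool" where
  "BKP K gs g m \<longleftrightarrow>
     (\<exists>es. length es = length gs \<and> (\<forall>e \<in> set es. e \<le> m) \<and> g = knapsack_prod K gs es)"

text \<open>
  An instance is given by words over the generators and their inverses, and its size is the
  total length of these words, not of shortest representatives.  A bound in an instance of the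
  bounded problem is a positive integer, so the polynomial must take positive values.
\<close>

definition knapsack_bounded_by ::
    "('a, 'm) monoid_scheme \<Rightarrow> 'a set \<Rightarrow> int poly \<Rightarrow> bool" where
  "knapsack_bounded_by K X q \<longleftrightarrow>
     (\<forall>n::nat. poly q (int n) > 0) \<and>
     (\<forall>ws w. set ws \<subseteq> group_words K X \<and> w \<in> group_words K X \<longrightarrow>
        (let gs = map (list_mult K) ws;
             g = list_mult K w;
             N = sum_list (map length ws) + length w
         in KP K gs g \<longleftrightarrow> BKP K gs g (nat (poly q (int N)))))"

definition poly_bounded_knapsack_group :: "('a, 'm) monoid_scheme \<Rightarrow> bool" where
  "poly_bounded_knapsack_group K \<longleftrightarrow>
     group K \<and> (\<exists>X q. finite_gen_set K X \<and> knapsack_bounded_by K X q)"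


subsection \<open>Independence of the generating set\<close>

lemma BKP_mono: "BKP K gs g m \<Longrightarrow> m \<le> m' \<Longrightarrow> BKP K gs g m'"
  unfolding BKP_def using le_trans by blast

lemma BKP_imp_KP: "BKP K gs g m \<Longrightarrow> KP K gs g"
  unfolding BKP_def KP_def by blast

lemma list_mult_simps [simp]:
  "list_mult K [] = \<one>\<^bsub>K\<^esub>"
  "list_mult K (x # xs) = x \<otimes>\<^bsub>K\<^esub> list_mult K xs"
  by (simp_all add: list_mult_def)

lemma list_mult_closed:
  assumes "group K" "set xs \<subseteq> carrier K"
  shows "list_mult K xs \<in> carrier K"
  using assms(2) by (induction xs) (auto intro!: monoid.m_closed monoid.one_closed group.is_monoid[OF assms(1)])

lemma list_mult_append:
  assumes "group K" "set xs \<subseteq> carrier K" "set ys \<subseteq> carrier K"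
  shows "list_mult K (xs @ ys) = list_mult K xs \<otimes>\<^bsub>K\<^esub> list_mult K ys"
proof -
  interpret group K by fact
  show ?thesis
    using assms(2)
    by (induction xs) (auto simp: m_assoc list_mult_closed[OF assms(1)] assms(3))
qed

lemma group_words_carrier:
  assumes "group K" "X \<subseteq> carrier K" "w \<in> group_words K X"
  shows "set w \<subseteq> carrier K"
proof -
  interpret group K by fact
  show ?thesis using assms(2,3) by (auto simp: group_words_def)
qed

lemma generate_imp_word:
  assumes "group K" "X \<subseteq> carrier K" "g \<in> generate K X"
  shows "\<exists>w \<in> group_words K X. list_mult K w = g"
  using assms(3)
proof (induction rule: generate.induct)
  case one
  show ?case by (rule bexI[of _ "[]"]) (auto simp: group_words_def)
next
  case (incl h)
  interpret group K by fact
  show ?case using incl assms(2) by (intro bexI[of _ "[h]"]) (auto simp: group_words_def)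
next
  case (inv h)
  interpret group K by fact
  show ?case using inv assms(2)
    by (intro bexI[of _ "[inv\<^bsub>K\<^esub> h]"]) (auto simp: group_words_def)
next
  case (eng h1 h2)
  then obtain u v where "u \<in> group_words K X" "list_mult K u = h1"
    "v \<in> group_words K X" "list_mult K v = h2" by blast
  moreover from this have "u @ v \<in> group_words K X" by (auto simp: group_words_def)
  ultimately show ?case
    using list_mult_append[OF assms(1) group_words_carrier[OF assms(1,2)]
        group_words_carrier[OF assms(1,2)], of u v] by blast
qed

lemma poly_majorant:
  fixes q :: "int poly" and c :: int
  assumes "c \<ge> 0"
  shows "\<exists>r. (\<forall>m\<ge>0. poly r m > 0) \<and> (\<forall>n m. 0 \<le> n \<and> 0 \<le> m \<and> n \<le> c * m \<longrightarrow> poly q n \<le> poly r m)"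
proof (induction q)
  case 0
  show ?case by (rule exI[of _ 1]) auto
next
  case (pCons a p)
  then obtain r where r: "\<And>m. m \<ge> 0 \<Longrightarrow> poly r m > 0"
    "\<And>n m. 0 \<le> n \<Longrightarrow> 0 \<le> m \<Longrightarrow> n \<le> c * m \<Longrightarrow> poly p n \<le> poly r m" by blast
  let ?r = "[:\<bar>a\<bar> + 1:] + [:0, c:] * r"
  have 1: "poly ?r m > 0" if "m \<ge> 0" for m
  proof -
    have "0 \<le> m * c * poly r m" using that assms r(1)[of m] by simp
    thus ?thesis by simp
  qed
  have 2: "poly (pCons a p) n \<le> poly ?r m" if "0 \<le> n" "0 \<le> m" "n \<le> c * m" for n m
  proof -
    have "n * poly p n \<le> n * poly r m" using r(2) that by (intro mult_left_mono) auto
    also have "\<dots> \<le> c * m * poly r m"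
      using r(1)[of m] that by (intro mult_right_mono) auto
    finally show ?thesis by (simp add: mult_ac)
  qed
  show ?case using 1 2 by blast
qed

lemma knapsack_bounded_by_change_gen_set:
  assumes "group K" "finite_gen_set K X" "finite_gen_set K Y" "knapsack_bounded_by K X q"
  shows "\<exists>r. knapsack_bounded_by K Y r"
proof -
  interpret group K by fact
  let ?Y = "Y \<union> m_inv K ` Y"
  have X: "X \<subseteq> carrier K" "generate K X = carrier K" and Y: "finite Y" "Y \<subseteq> carrier K"
    using assms(2,3) by (auto simp: finite_gen_set_def)
  have "\<forall>y \<in> ?Y. \<exists>w. w \<in> group_words K X \<and> list_mult K w = y"
    using generate_imp_word[OF assms(1) X(1)] X(2) Y(2) by blast
  then obtain t where t: "\<And>y. y \<in> ?Y \<Longrightarrow> t y \<in> group_words K X \<and> list_mult K (t y) = y"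
    by metis
  obtain c where c: "\<And>y. y \<in> ?Y \<Longrightarrow> length (t y) \<le> c"
    using finite_nat_set_iff_bounded_le[of "(\<lambda>y. length (t y)) ` ?Y"] Y(1) by auto
  define T where "T w = concat (map t w)" for w
  have T: "T w \<in> group_words K X \<and> list_mult K (T w) = list_mult K w \<and> length (T w) \<le> c * length w"
    if "w \<in> group_words K Y" for w
  proof -
    have "set w \<subseteq> ?Y" using that by (auto simp: group_words_def)
    thus ?thesis
    proof (induction w)
      case Nil
      show ?case by (simp add: T_def group_words_def)
    next
      case (Cons y w)
      have IH: "T w \<in> group_words K X" "list_mult K (T w) = list_mult K w" "length (T w) \<le> c * length w"
        and y: "y \<in> ?Y" using Cons by auto
      have T_Cons: "T (y # w) = t y @ T w" by (simp add: T_def)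
      have "list_mult K (T (y # w)) = y \<otimes>\<^bsub>K\<^esub> list_mult K w"
        unfolding T_Cons
        using list_mult_append[OF assms(1) group_words_carrier[OF assms(1) X(1)]
            group_words_carrier[OF assms(1) X(1)], of "t y" "T w"] t[OF y] IH by simp
      moreover have "T (y # w) \<in> group_words K X"
        unfolding T_Cons using t[OF y] IH(1) by (auto simp: group_words_def)
      ultimately show ?case using c[OF y] IH(3) by (simp add: T_Cons)
    qed
  qed
  obtain r where r: "\<And>m. m \<ge> 0 \<Longrightarrow> poly r m > 0"
    "\<And>n m. 0 \<le> n \<Longrightarrow> 0 \<le> m \<Longrightarrow> n \<le> int c * m \<Longrightarrow> poly q n \<le> poly r m"
    using poly_majorant[of "int c" q] by auto
  have "KP K (map (list_mult K) ws) (list_mult K w) \<longleftrightarrow>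
        BKP K (map (list_mult K) ws) (list_mult K w)
          (nat (poly r (int (sum_list (map length ws) + length w))))"
    (is "KP K ?gs ?g \<longleftrightarrow> BKP K ?gs ?g (nat (poly r (int ?M)))")
    if ws: "set ws \<subseteq> group_words K Y" "w \<in> group_words K Y" for ws w
  proof
    assume KP: "KP K ?gs ?g"
    define N where "N = sum_list (map length (map T ws)) + length (T w)"
    have eq: "map (list_mult K) (map T ws) = ?gs" "list_mult K (T w) = ?g"
      using ws T by auto
    have "sum_list (map length (map T ws)) \<le> c * sum_list (map length ws)"
      using ws(1)
    proof (induction ws)
      case (Cons u us)
      thus ?case using T[of u] by (simp add: algebra_simps)
    qed simp
    hence "N \<le> c * ?M" using T[OF ws(2)] by (simp add: N_def algebra_simps)
    hence le: "poly q (int N) \<le> poly r (int ?M)"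
      by (intro r(2)) (simp_all flip: of_nat_mult of_nat_add)
    have "set (map T ws) \<subseteq> group_words K X \<and> T w \<in> group_words K X" using ws T by auto
    hence "BKP K ?gs ?g (nat (poly q (int N)))"
      using assms(4) KP eq unfolding knapsack_bounded_by_def Let_def N_def by metis
    thus "BKP K ?gs ?g (nat (poly r (int ?M)))" by (rule BKP_mono) (use le in simp)
  qed (rule BKP_imp_KP)
  thus ?thesis using r(1) unfolding knapsack_bounded_by_def Let_def by (intro exI[of _ r]) auto
qed


section \<open>Free products\<close>

text \<open>
  Elements of the free product are the words that alternate between nontrivial elements of
  \<open>G\<close>, tagged \<open>Inl\<close>, and nontrivial elements of \<open>H\<close>, tagged \<open>Inr\<close>.
\<close>

definition fp_letters ::
    "('a, 'm) monoid_scheme \<Rightarrow> ('b, 'n) monoid_scheme \<Rightarrow> ('a + 'b) set" where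
  "fp_letters G H = Inl ` (carrier G - {\<one>\<^bsub>G\<^esub>}) \<union> Inr ` (carrier H - {\<one>\<^bsub>H\<^esub>})"

definition fp_reduced ::
    "('a, 'm) monoid_scheme \<Rightarrow> ('b, 'n) monoid_scheme \<Rightarrow> ('a + 'b) list set" where
  "fp_reduced G H = {w. set w \<subseteq> fp_letters G H \<and> successively (\<lambda>x y. isl x \<noteq> isl y) w}"

text \<open>The reduced form of the product of a letter, possibly trivial, and a reduced word.\<close>

fun fp_cons :: "('a, 'm) monoid_scheme \<Rightarrow> ('b, 'n) monoid_scheme \<Rightarrow>
    'a + 'b \<Rightarrow> ('a + 'b) list \<Rightarrow> ('a + 'b) list" where
  "fp_cons G H (Inl a) (Inl b # w) =
     (if a \<otimes>\<^bsub>G\<^esub> b = \<one>\<^bsub>G\<^esub> then w else Inl (a \<otimes>\<^bsub>G\<^esub> b) # w)"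
| "fp_cons G H (Inr a) (Inr b # w) =
     (if a \<otimes>\<^bsub>H\<^esub> b = \<one>\<^bsub>H\<^esub> then w else Inr (a \<otimes>\<^bsub>H\<^esub> b) # w)"
| "fp_cons G H (Inl a) w = (if a = \<one>\<^bsub>G\<^esub> then w else Inl a # w)"
| "fp_cons G H (Inr a) w = (if a = \<one>\<^bsub>H\<^esub> then w else Inr a # w)"

definition free_product ::
    "('a, 'm) monoid_scheme \<Rightarrow> ('b, 'n) monoid_scheme \<Rightarrow> ('a + 'b) list monoid" where
  "free_product G H =
     \<lparr>carrier = fp_reduced G H, monoid.mult = foldr (fp_cons G H), one = []\<rparr>"

definition fp_inl ::
    "('a, 'm) monoid_scheme \<Rightarrow> ('b, 'n) monoid_scheme \<Rightarrow> 'a \<Rightarrow> ('a + 'b) list" where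
  "fp_inl G H a = fp_cons G H (Inl a) []"

definition fp_inr ::
    "('a, 'm) monoid_scheme \<Rightarrow> ('b, 'n) monoid_scheme \<Rightarrow> 'b \<Rightarrow> ('a + 'b) list" where
  "fp_inr G H b = fp_cons G H (Inr b) []"


subsection \<open>Group structure and universal property\<close>

lemma free_product_simps [simp]:
  "carrier (free_product G H) = fp_reduced G H"
  "(\<otimes>\<^bsub>free_product G H\<^esub>) = foldr (fp_cons G H)"
  "\<one>\<^bsub>free_product G H\<^esub> = []"
  by (simp_all add: free_product_def)

lemma Nil_fp_reduced [simp]: "[] \<in> fp_reduced G H"
  by (simp add: fp_reduced_def)

lemma Cons_fp_reduced_iff:
  "x # w \<in> fp_reduced G H \<longleftrightarrow>
     x \<in> fp_letters G H \<and> w \<in> fp_reduced G H \<and> (w = [] \<or> isl x \<noteq> isl (hd w))"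
  by (auto simp: fp_reduced_def successively_Cons)

locale two_groups = G: group G + H: group H
  for G :: "('a, 'm) monoid_scheme" and H :: "('b, 'n) monoid_scheme"
begin

lemma fp_cons_closed:
  assumes "x \<in> Inl ` carrier G \<union> Inr ` carrier H" "w \<in> fp_reduced G H"
  shows "fp_cons G H x w \<in> fp_reduced G H"
proof (cases w)
  case Nil
  thus ?thesis using assms by (auto simp: Cons_fp_reduced_iff fp_letters_def split: if_splits)
next
  case (Cons y v)
  thus ?thesis using assms
    by (cases x; cases y) (auto simp: Cons_fp_reduced_iff fp_letters_def split: if_splits)
qed

lemma fp_cons_one:
  assumes "w \<in> fp_reduced G H"
  shows "fp_cons G H (Inl \<one>\<^bsub>G\<^esub>) w = w" "fp_cons G H (Inr \<one>\<^bsub>H\<^esub>) w = w"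
proof -
  have "fp_cons G H (Inl \<one>\<^bsub>G\<^esub>) w = w \<and> fp_cons G H (Inr \<one>\<^bsub>H\<^esub>) w = w"
  proof (cases w)
    case (Cons y v)
    thus ?thesis using assms by (cases y) (auto simp: Cons_fp_reduced_iff fp_letters_def)
  qed simp
  thus "fp_cons G H (Inl \<one>\<^bsub>G\<^esub>) w = w" "fp_cons G H (Inr \<one>\<^bsub>H\<^esub>) w = w" by auto
qed

lemma fp_cons_not_isl:
  "w = [] \<or> \<not> isl (hd w) \<Longrightarrow> fp_cons G H (Inl a) w = (if a = \<one>\<^bsub>G\<^esub> then w else Inl a # w)"
  by (cases w; cases "hd w") auto

lemma fp_cons_isl:
  "w = [] \<or> isl (hd w) \<Longrightarrow> fp_cons G H (Inr a) w = (if a = \<one>\<^bsub>H\<^esub> then w else Inr a # w)"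
  by (cases w; cases "hd w") auto

lemma fp_cons_Inl_Inl:
  assumes "a \<in> carrier G" "b \<in> carrier G" "w \<in> fp_reduced G H"
  shows "fp_cons G H (Inl a) (fp_cons G H (Inl b) w) = fp_cons G H (Inl (a \<otimes>\<^bsub>G\<^esub> b)) w"
proof -
  obtain c v where cv: "c \<in> carrier G" "v = [] \<or> \<not> isl (hd v)"
      "\<And>a. a \<in> carrier G \<Longrightarrow> fp_cons G H (Inl a) w = fp_cons G H (Inl (a \<otimes>\<^bsub>G\<^esub> c)) v"
  proof (cases "w = [] \<or> \<not> isl (hd w)")
    case True
    show ?thesis by (rule that[of "\<one>\<^bsub>G\<^esub>" w]) (use True in auto)
  next
    case False
    then obtain c v where w: "w = Inl c # v" by (cases w; cases "hd w") auto
    show ?thesis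
      by (rule that[of c v])
        (use assms(3) in \<open>auto simp: w Cons_fp_reduced_iff fp_letters_def fp_cons_not_isl\<close>)
  qed
  have *: "fp_cons G H (Inl a) (fp_cons G H (Inl d) v) = fp_cons G H (Inl (a \<otimes>\<^bsub>G\<^esub> d)) v"
    if "d \<in> carrier G" for d
    using cv(2) assms(1) that by (auto simp: fp_cons_not_isl)
  show ?thesis using assms(1,2) cv(1,3) * by (simp add: G.m_assoc)
qed

lemma fp_cons_Inr_Inr:
  assumes "a \<in> carrier H" "b \<in> carrier H" "w \<in> fp_reduced G H"
  shows "fp_cons G H (Inr a) (fp_cons G H (Inr b) w) = fp_cons G H (Inr (a \<otimes>\<^bsub>H\<^esub> b)) w"
proof -
  obtain c v where cv: "c \<in> carrier H" "v = [] \<or> isl (hd v)"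
      "\<And>a. a \<in> carrier H \<Longrightarrow> fp_cons G H (Inr a) w = fp_cons G H (Inr (a \<otimes>\<^bsub>H\<^esub> c)) v"
  proof (cases "w = [] \<or> isl (hd w)")
    case True
    show ?thesis by (rule that[of "\<one>\<^bsub>H\<^esub>" w]) (use True in auto)
  next
    case False
    then obtain c v where w: "w = Inr c # v" by (cases w; cases "hd w") auto
    show ?thesis
      by (rule that[of c v])
        (use assms(3) in \<open>auto simp: w Cons_fp_reduced_iff fp_letters_def fp_cons_isl\<close>)
  qed
  have *: "fp_cons G H (Inr a) (fp_cons G H (Inr d) v) = fp_cons G H (Inr (a \<otimes>\<^bsub>H\<^esub> d)) v"
    if "d \<in> carrier H" for d
    using cv(2) assms(1) that by (auto simp: fp_cons_isl)
  show ?thesis using assms(1,2) cv(1,3) * by (simp add: H.m_assoc)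
qed

lemma fp_mult_closed:
  assumes "set u \<subseteq> Inl ` carrier G \<union> Inr ` carrier H" "w \<in> fp_reduced G H"
  shows "foldr (fp_cons G H) u w \<in> fp_reduced G H"
  using assms(1)
proof (induction u)
  case (Cons x u)
  hence "foldr (fp_cons G H) u w \<in> fp_reduced G H" "x \<in> Inl ` carrier G \<union> Inr ` carrier H"
    by simp_all
  thus ?case by (simp add: fp_cons_closed)
qed (simp add: assms)

lemma fp_reduced_letters:
  "w \<in> fp_reduced G H \<Longrightarrow> set w \<subseteq> Inl ` carrier G \<union> Inr ` carrier H"
  by (auto simp: fp_reduced_def fp_letters_def)

lemma fp_mult_cons:
  assumes x: "x \<in> Inl ` carrier G \<union> Inr ` carrier H"
    and v: "v \<in> fp_reduced G H" and w: "w \<in> fp_reduced G H"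
  shows "foldr (fp_cons G H) (fp_cons G H x v) w = fp_cons G H x (foldr (fp_cons G H) v w)"
proof (cases v)
  case Nil
  thus ?thesis using x w by (auto simp: fp_cons_one)
next
  case (Cons y u)
  have "u \<in> fp_reduced G H" and y: "y \<in> fp_letters G H"
    using v Cons by (auto simp: Cons_fp_reduced_iff)
  hence u: "foldr (fp_cons G H) u w \<in> fp_reduced G H"
    using fp_mult_closed fp_reduced_letters w by blast
  have "foldr (fp_cons G H) v w \<in> fp_reduced G H"
    using fp_mult_closed fp_reduced_letters v w by blast
  hence one: "fp_cons G H (Inl \<one>\<^bsub>G\<^esub>) (fp_cons G H y (foldr (fp_cons G H) u w))
      = fp_cons G H y (foldr (fp_cons G H) u w)"
    "fp_cons G H (Inr \<one>\<^bsub>H\<^esub>) (fp_cons G H y (foldr (fp_cons G H) u w))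
      = fp_cons G H y (foldr (fp_cons G H) u w)"
    using fp_cons_one Cons by auto
  have "fp_cons G H x (fp_cons G H y (foldr (fp_cons G H) u w))
      = foldr (fp_cons G H) (fp_cons G H x (y # u)) w"
  proof (cases x; cases y)
    fix a b assume xy: "x = Inl a" "y = Inl b"
    hence ab: "a \<in> carrier G" "b \<in> carrier G" using x y by (auto simp: fp_letters_def)
    show ?thesis
      using fp_cons_Inl_Inl[OF ab u] fp_cons_one[OF u] by (simp add: xy)
  next
    fix a b assume xy: "x = Inr a" "y = Inr b"
    hence ab: "a \<in> carrier H" "b \<in> carrier H" using x y by (auto simp: fp_letters_def)
    show ?thesis
      using fp_cons_Inr_Inr[OF ab u] fp_cons_one[OF u] by (simp add: xy)
  qed (use one in auto)
  thus ?thesis by (simp add: Cons)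
qed

lemma fp_mult_assoc:
  assumes "set u \<subseteq> Inl ` carrier G \<union> Inr ` carrier H" "v \<in> fp_reduced G H" "w \<in> fp_reduced G H"
  shows "foldr (fp_cons G H) (foldr (fp_cons G H) u v) w
    = foldr (fp_cons G H) u (foldr (fp_cons G H) v w)"
  using assms(1)
proof (induction u)
  case (Cons x u)
  thus ?case using fp_mult_cons[OF _ fp_mult_closed[OF _ assms(2)] assms(3), of x u] by simp
qed simp

lemma fp_mult_Nil: "u \<in> fp_reduced G H \<Longrightarrow> foldr (fp_cons G H) u [] = u"
proof (induction u)
  case (Cons x u)
  hence "u \<in> fp_reduced G H" "x \<in> fp_letters G H" "u = [] \<or> isl x \<noteq> isl (hd u)"
    by (auto simp: Cons_fp_reduced_iff)
  thus ?case using Cons.IH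
    by (cases x) (auto simp: fp_cons_isl fp_cons_not_isl fp_letters_def)
qed simp

lemma fp_left_inverse:
  assumes "u \<in> fp_reduced G H"
  shows "\<exists>v. v \<in> fp_reduced G H \<and> foldr (fp_cons G H) v u = []"
  using assms
proof (induction u)
  case Nil
  show ?case by (rule exI[of _ "[]"]) simp
next
  case (Cons x u)
  hence u: "u \<in> fp_reduced G H" and x: "x \<in> fp_letters G H" by (auto simp: Cons_fp_reduced_iff)
  from Cons.IH[OF u] obtain v where v: "v \<in> fp_reduced G H" "foldr (fp_cons G H) v u = []" by blast
  define y where "y = map_sum (m_inv G) (m_inv H) x"
  have y: "y \<in> Inl ` carrier G \<union> Inr ` carrier H" and yx: "fp_cons G H y (x # u) = u"
    using x by (auto simp: y_def fp_letters_def)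
  have y_red: "fp_cons G H y [] \<in> fp_reduced G H" using y by (rule fp_cons_closed) simp
  have "foldr (fp_cons G H) (foldr (fp_cons G H) v (fp_cons G H y [])) (x # u)
      = foldr (fp_cons G H) v (foldr (fp_cons G H) (fp_cons G H y []) (x # u))"
    using fp_mult_assoc[OF fp_reduced_letters[OF v(1)] y_red Cons.prems] .
  also have "foldr (fp_cons G H) (fp_cons G H y []) (x # u) = u"
    using fp_mult_cons[OF y _ Cons.prems, of "[]"] yx by simp
  finally show ?case
    using v(2) fp_mult_closed[OF fp_reduced_letters[OF v(1)] y_red] by auto
qed

theorem group_free_product: "group (free_product G H)"
proof (rule groupI)
  fix u v assume "u \<in> carrier (free_product G H)" "v \<in> carrier (free_product G H)"
  thus "u \<otimes>\<^bsub>free_product G H\<^esub> v \<in> carrier (free_product G H)"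
    by (simp add: fp_mult_closed fp_reduced_letters)
next
  fix u v w
  assume "u \<in> carrier (free_product G H)" "v \<in> carrier (free_product G H)"
    "w \<in> carrier (free_product G H)"
  thus "u \<otimes>\<^bsub>free_product G H\<^esub> v \<otimes>\<^bsub>free_product G H\<^esub> w
      = u \<otimes>\<^bsub>free_product G H\<^esub> (v \<otimes>\<^bsub>free_product G H\<^esub> w)"
    by (simp add: fp_mult_assoc fp_reduced_letters)
qed (use fp_left_inverse in auto)

lemma fp_inl_hom: "fp_inl G H \<in> hom G (free_product G H)"
proof (rule homI)
  fix a b assume ab: "a \<in> carrier G" "b \<in> carrier G"
  have "foldr (fp_cons G H) (fp_inl G H a) (fp_inl G H b)
      = fp_cons G H (Inl a) (fp_cons G H (Inl b) [])"
    using fp_mult_cons[of "Inl a" "[]" "fp_cons G H (Inl b) []"] ab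
    by (simp add: fp_inl_def fp_cons_closed del: fp_cons.simps)
  thus "fp_inl G H (a \<otimes>\<^bsub>G\<^esub> b) = fp_inl G H a \<otimes>\<^bsub>free_product G H\<^esub> fp_inl G H b"
    using ab fp_cons_Inl_Inl[of a b "[]"] by (simp add: fp_inl_def del: fp_cons.simps)
qed (simp add: fp_inl_def fp_cons_closed del: fp_cons.simps)

lemma fp_inr_hom: "fp_inr G H \<in> hom H (free_product G H)"
proof (rule homI)
  fix a b assume ab: "a \<in> carrier H" "b \<in> carrier H"
  have "foldr (fp_cons G H) (fp_inr G H a) (fp_inr G H b)
      = fp_cons G H (Inr a) (fp_cons G H (Inr b) [])"
    using fp_mult_cons[of "Inr a" "[]" "fp_cons G H (Inr b) []"] ab
    by (simp add: fp_inr_def fp_cons_closed del: fp_cons.simps)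
  thus "fp_inr G H (a \<otimes>\<^bsub>H\<^esub> b) = fp_inr G H a \<otimes>\<^bsub>free_product G H\<^esub> fp_inr G H b"
    using ab fp_cons_Inr_Inr[of a b "[]"] by (simp add: fp_inr_def del: fp_cons.simps)
qed (simp add: fp_inr_def fp_cons_closed del: fp_cons.simps)

theorem free_product_universal:
  assumes K: "group K" and f: "f \<in> hom G K" and g: "g \<in> hom H K"
  shows "\<exists>h \<in> hom (free_product G H) K.
    (\<forall>a \<in> carrier G. h (fp_inl G H a) = f a) \<and> (\<forall>b \<in> carrier H. h (fp_inr G H b) = g b)"
proof -
  interpret K: group K by fact
  interpret f: group_hom G K f by unfold_locales (rule f)
  interpret g: group_hom H K g by unfold_locales (rule g)
  define F where "F = case_sum f g"
  define h where "h w = list_mult K (map F w)" for w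
  have F: "F x \<in> carrier K" if "x \<in> Inl ` carrier G \<union> Inr ` carrier H" for x
    using that by (auto simp: F_def)
  have h: "h w \<in> carrier K" if "set w \<subseteq> Inl ` carrier G \<union> Inr ` carrier H" for w
    unfolding h_def using that F by (intro list_mult_closed K) auto
  have step: "h (fp_cons G H x w) = F x \<otimes>\<^bsub>K\<^esub> h w"
    if x: "x \<in> Inl ` carrier G \<union> Inr ` carrier H" and w: "w \<in> fp_reduced G H" for x w
  proof (cases w)
    case Nil
    thus ?thesis using x by (auto simp: h_def F_def)
  next
    case (Cons y v)
    have y: "y \<in> Inl ` carrier G \<union> Inr ` carrier H" and v: "h v \<in> carrier K"
      using fp_reduced_letters[OF w] Cons by (auto intro: h)
    have hw: "h w = F y \<otimes>\<^bsub>K\<^esub> h v" by (simp add: h_def Cons)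
    have h_Cons: "h (z # v) = F z \<otimes>\<^bsub>K\<^esub> h v" for z by (simp add: h_def)
    have one: "F (Inl \<one>\<^bsub>G\<^esub>) = \<one>\<^bsub>K\<^esub>" "F (Inr \<one>\<^bsub>H\<^esub>) = \<one>\<^bsub>K\<^esub>" by (auto simp: F_def)
    show ?thesis
    proof (cases x; cases y)
      fix a b assume xy: "x = Inl a" "y = Inl b"
      hence ab: "a \<in> carrier G" "b \<in> carrier G" using x y by auto
      have "F (Inl (a \<otimes>\<^bsub>G\<^esub> b)) = F x \<otimes>\<^bsub>K\<^esub> F y" using ab by (simp add: F_def xy)
      hence "F (Inl (a \<otimes>\<^bsub>G\<^esub> b)) \<otimes>\<^bsub>K\<^esub> h v = F x \<otimes>\<^bsub>K\<^esub> h w"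
        using F[OF x] F[OF y] v by (simp add: hw K.m_assoc)
      thus ?thesis using one v by (auto simp: xy Cons h_Cons)
    next
      fix a b assume xy: "x = Inr a" "y = Inr b"
      hence ab: "a \<in> carrier H" "b \<in> carrier H" using x y by auto
      have "F (Inr (a \<otimes>\<^bsub>H\<^esub> b)) = F x \<otimes>\<^bsub>K\<^esub> F y" using ab by (simp add: F_def xy)
      hence "F (Inr (a \<otimes>\<^bsub>H\<^esub> b)) \<otimes>\<^bsub>K\<^esub> h v = F x \<otimes>\<^bsub>K\<^esub> h w"
        using F[OF x] F[OF y] v by (simp add: hw K.m_assoc)
      thus ?thesis using one v by (auto simp: xy Cons h_Cons)
    next
      fix a b assume xy: "x = Inl a" "y = Inr b"
      show ?thesis using one h[OF fp_reduced_letters[OF w]] by (auto simp: xy Cons h_def)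
    next
      fix a b assume xy: "x = Inr a" "y = Inl b"
      show ?thesis using one h[OF fp_reduced_letters[OF w]] by (auto simp: xy Cons h_def)
    qed
  qed
  have mult: "h (foldr (fp_cons G H) u w) = h u \<otimes>\<^bsub>K\<^esub> h w"
    if "set u \<subseteq> Inl ` carrier G \<union> Inr ` carrier H" "w \<in> fp_reduced G H" for u w
    using that(1)
  proof (induction u)
    case Nil
    show ?case using h[OF fp_reduced_letters[OF that(2)]] by (simp add: h_def)
  next
    case (Cons x u)
    hence "h (foldr (fp_cons G H) (x # u) w) = F x \<otimes>\<^bsub>K\<^esub> (h u \<otimes>\<^bsub>K\<^esub> h w)"
      using step[OF _ fp_mult_closed[OF _ that(2)], of x u] by simp
    also have "\<dots> = h (x # u) \<otimes>\<^bsub>K\<^esub> h w"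
      using Cons.prems h[of u] F[of x] h[OF fp_reduced_letters[OF that(2)]]
      by (simp add: h_def K.m_assoc)
    finally show ?case .
  qed
  have "h \<in> hom (free_product G H) K"
    by (rule homI) (auto simp: h mult fp_reduced_letters)
  moreover have "h (fp_inl G H a) = f a" if "a \<in> carrier G" for a
    using that by (auto simp: fp_inl_def h_def F_def)
  moreover have "h (fp_inr G H b) = g b" if "b \<in> carrier H" for b
    using that by (auto simp: fp_inr_def h_def F_def)
  ultimately show ?thesis by blast
qed

theorem free_product_universal_unique:
  assumes K: "group K"
    and h: "h \<in> hom (free_product G H) K" and h': "h' \<in> hom (free_product G H) K"
    and inl: "\<And>a. a \<in> carrier G \<Longrightarrow> h (fp_inl G H a) = h' (fp_inl G H a)"
    and inr: "\<And>b. b \<in> carrier H \<Longrightarrow> h (fp_inr G H b) = h' (fp_inr G H b)"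
    and w: "w \<in> carrier (free_product G H)"
  shows "h w = h' w"
proof -
  interpret h: group_hom "free_product G H" K h
    using group_free_product K h by (simp add: group_hom_def group_hom_axioms_def)
  interpret h': group_hom "free_product G H" K h'
    using group_free_product K h' by (simp add: group_hom_def group_hom_axioms_def)
  have "w \<in> fp_reduced G H" using w by simp
  thus ?thesis
  proof (induction w)
    case Nil
    show ?case using h.hom_one h'.hom_one by simp
  next
    case (Cons x w)
    hence w: "w \<in> fp_reduced G H" and x: "x \<in> fp_letters G H" by (auto simp: Cons_fp_reduced_iff)
    hence x_red: "[x] \<in> fp_reduced G H" by (simp add: Cons_fp_reduced_iff)
    have "h [x] = h' [x]"
    proof (cases x)
      case (Inl a)
      thus ?thesis using x inl[of a] by (auto simp: fp_letters_def fp_inl_def split: if_splits)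
    next
      case (Inr b)
      thus ?thesis using x inr[of b] by (auto simp: fp_letters_def fp_inr_def split: if_splits)
    qed
    moreover have "x # w = [x] \<otimes>\<^bsub>free_product G H\<^esub> w"
      using fp_mult_Nil[OF Cons.prems] fp_mult_Nil[OF w] by simp
    ultimately show ?case
      using h.hom_mult[of "[x]" w] h'.hom_mult[of "[x]" w] Cons.IH[OF w] x_red w
      by (simp del: foldr.simps)
  qed
qed

end

end

theory Submission
  imports Defs "HOL-Library.Sublist"
begin

text \<open>
  An instance asks for exponents with \<open>g\<^sub>1\<^bsup>e\<^sub>1\<^esup> \<dots> g\<^sub>k\<^bsup>e\<^sub>k\<^esup> = g\<close> in the free product.  Every
  \<open>g\<^sub>i\<close> is a conjugate \<open>c u c\<^sup>-\<^sup>1\<close>, where \<open>u\<close> is either empty or one letter, that is, an element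
  of a factor (elliptic), or cyclically reduced (hyperbolic); \<open>c\<close> and \<open>u\<close> together have at most
  twice the size of \<open>g\<^sub>i\<close> (\<open>cyclically_reduced_conjugate\<close>).  So a solution is a word of letters
  from both factors, built from constants and powers, whose value is \<open>1\<close>.  The two kinds of
  exponents are bounded by different arguments.

  Hyperbolic exponents.  Evaluate the word from right to left with a stack that holds a reduced
  word.  Every nontrivial letter pushes an entry or acts on the top entry.  As the stack is
  empty at both ends, every nontrivial letter acts on the same entry as some other letter
  (\<open>arc_exists\<close>), and the arcs between consecutive actions on one entry do not cross
  (\<open>arcs_noncrossing\<close>).  A power of a cyclically reduced word is reduced, so its arcs lead out
  of it.  If the exponent exceeds twice the number of symbols of the equation, two periods have
  arcs that go in the same direction to occurrences of the same symbol.  The two parts of the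
  word between these arcs are inverse to each other, and each consists of full periods up to a
  cyclic shift, so deleting both gives a solution with smaller exponents (\<open>nested_arcs_cut\<close>).
  Hence in a solution with least exponent sum all hyperbolic exponents are at most linear in the
  length of the instance (\<open>minimal_solution_bound\<close>).

  Elliptic exponents.  With the hyperbolic exponents fixed, the word is a sequence of
  polynomially many letters, some of which are powers with unknown exponent of an element of a
  factor.  A word of value \<open>1\<close> collapses by removing trivial letters and multiplying neighbours
  from the same factor.  Carried out symbolically, this splits the equation into equations in
  single factors, each of which is a knapsack instance after conjugation by its constants
  (\<open>bounded_blocks\<close>).  Their total size is polynomial, so the bounds of \<open>G\<close> and \<open>H\<close> apply.
\<close>

section \<open>Length functions of knapsack groups\<close>

definition word_norm :: "('a, 'm) monoid_scheme \<Rightarrow> 'a set \<Rightarrow> 'a \<Rightarrow> nat" where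
  "word_norm K X a = (LEAST n. \<exists>w \<in> group_words K X. length w = n \<and> list_mult K w = a)"

text \<open>
  Instances are measured by the shortest words \<open>nu\<close> instead of given words, since the instances
  in the factors are computed from group elements.  The bound \<open>Q\<close> takes any upper estimate of
  the size, which replaces monotonicity of the bounding polynomial.
\<close>

locale normed_knapsack_group = group K for K :: "('a, 'm) monoid_scheme" (structure) +
  fixes nu :: "'a \<Rightarrow> nat" and Q :: "nat \<Rightarrow> nat"
  assumes nu_one: "nu \<one> = 0"
    and nu_mult: "a \<in> carrier K \<Longrightarrow> b \<in> carrier K \<Longrightarrow> nu (a \<otimes> b) \<le> nu a + nu b"
    and nu_inv: "a \<in> carrier K \<Longrightarrow> nu (inv a) \<le> nu a"
    and bounded: "set gs \<subseteq> carrier K \<Longrightarrow> g \<in> carrier K \<Longrightarrow> KP K gs g \<Longrightarrow>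
      sum_list (map nu gs) + nu g \<le> n \<Longrightarrow> BKP K gs g (Q n)"

lemma list_mult_inverse_word:
  assumes "group K" "set w \<subseteq> carrier K"
  shows "list_mult K (rev (map (m_inv K) w)) = m_inv K (list_mult K w)"
proof -
  interpret group K by fact
  show ?thesis using assms(2)
  proof (induction w)
    case (Cons a w)
    hence "set (rev (map (m_inv K) w)) \<subseteq> carrier K" "set [inv\<^bsub>K\<^esub> a] \<subseteq> carrier K" by auto
    from list_mult_append[OF assms(1) this] show ?case
      using Cons by (simp add: list_mult_closed[OF assms(1)] inv_mult_group)
  qed simp
qed

lemma poly_bounded_knapsack_group_norm:
  fixes K :: "('a, 'm) monoid_scheme"
  assumes "poly_bounded_knapsack_group K"
  obtains X nu r where "finite_gen_set K X" "\<And>x. x \<in> X \<union> m_inv K ` X \<Longrightarrow> nu x \<le> 1"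
    "\<And>n::int. n \<ge> 0 \<Longrightarrow> poly r n > 0"
    "normed_knapsack_group K nu (\<lambda>n. nat (poly r (int n)))"
proof -
  from assms obtain X q where K: "group K" and X: "finite_gen_set K X"
    and q: "knapsack_bounded_by K X q"
    unfolding poly_bounded_knapsack_group_def by blast
  interpret group K by fact
  have XK: "X \<subseteq> carrier K" "generate K X = carrier K" using X by (auto simp: finite_gen_set_def)
  note carr = group_words_carrier[OF K XK(1)]
  obtain r where "(\<forall>m\<ge>0. poly r m > 0) \<and> (\<forall>n m. 0 \<le> n \<and> 0 \<le> m \<and> n \<le> 1 * m \<longrightarrow> poly q n \<le> poly r m)"
    using poly_majorant[OF zero_le_one, of q] by (elim exE)
  hence r: "\<And>m. m \<ge> 0 \<Longrightarrow> poly r m > 0"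
    "\<And>n m. 0 \<le> n \<Longrightarrow> 0 \<le> m \<Longrightarrow> n \<le> m \<Longrightarrow> poly q n \<le> poly r m"
    by simp_all
  let ?nu = "word_norm K X"
  have ex: "\<exists>w \<in> group_words K X. length w = ?nu a \<and> list_mult K w = a" if "a \<in> carrier K" for a
  proof -
    have "a \<in> generate K X" using that by (simp only: XK(2))
    from generate_imp_word[OF K XK(1) this]
    have "\<exists>n. \<exists>w \<in> group_words K X. length w = n \<and> list_mult K w = a" by blast
    from LeastI_ex[OF this] show ?thesis unfolding word_norm_def .
  qed
  have le: "?nu a \<le> length w" if "w \<in> group_words K X" "list_mult K w = a" for a w
    unfolding word_norm_def by (rule Least_le) (use that in blast)
  have "\<forall>a \<in> carrier K. \<exists>w. w \<in> group_words K X \<and> length w = ?nu a \<and> list_mult K w = a"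
    using ex by blast
  from bchoice[OF this] obtain W where "\<forall>a \<in> carrier K. W a \<in> group_words K X \<and> length (W a) = ?nu a \<and> list_mult K (W a) = a" ..
  hence W: "\<And>a. a \<in> carrier K \<Longrightarrow> W a \<in> group_words K X"
    "\<And>a. a \<in> carrier K \<Longrightarrow> length (W a) = ?nu a"
    "\<And>a. a \<in> carrier K \<Longrightarrow> list_mult K (W a) = a" by simp_all
  have "?nu x \<le> 1" if "x \<in> X \<union> m_inv K ` X" for x
  proof -
    have "x \<in> carrier K" using that XK(1) by auto
    thus ?thesis using le[of "[x]" x] that by (auto simp: group_words_def)
  qed
  moreover have "normed_knapsack_group K ?nu (\<lambda>n. nat (poly r (int n)))"
  proof
    show "?nu \<one>\<^bsub>K\<^esub> = 0" using le[of "[]"] by (auto simp: group_words_def)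
  next
    fix a b assume ab: "a \<in> carrier K" "b \<in> carrier K"
    have "W a @ W b \<in> group_words K X" using W(1) ab by (simp add: group_words_def)
    moreover have "list_mult K (W a @ W b) = a \<otimes>\<^bsub>K\<^esub> b"
      using list_mult_append[OF K carr[OF W(1)[OF ab(1)]] carr[OF W(1)[OF ab(2)]]] W(3) ab by simp
    ultimately show "?nu (a \<otimes>\<^bsub>K\<^esub> b) \<le> ?nu a + ?nu b"
      using le[of "W a @ W b"] W(2) ab by simp
  next
    fix a assume a: "a \<in> carrier K"
    have "rev (map (m_inv K) (W a)) \<in> group_words K X"
      using W(1)[OF a] XK(1) by (force simp: group_words_def in_lists_conv_set)
    moreover have "list_mult K (rev (map (m_inv K) (W a))) = inv\<^bsub>K\<^esub> a"
      using list_mult_inverse_word[OF K carr[OF W(1)[OF a]]] W(3)[OF a] by simp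
    ultimately show "?nu (inv\<^bsub>K\<^esub> a) \<le> ?nu a"
      using le[of "rev (map (m_inv K) (W a))"] W(2)[OF a] by simp
  next
    fix gs g n assume gs: "set gs \<subseteq> carrier K" and g: "g \<in> carrier K" and KP: "KP K gs g"
      and n: "sum_list (map ?nu gs) + ?nu g \<le> n"
    let ?N = "sum_list (map length (map W gs)) + length (W g)"
    have "map length (map W gs) = map ?nu gs" using gs W(2) by (simp add: subset_iff)
    hence N: "?N \<le> n" using n W(2)[OF g] by presburger
    have eq: "map (list_mult K) (map W gs) = gs" "list_mult K (W g) = g"
      using gs W(3) g by (simp_all add: map_idI subset_iff)
    have "set (map W gs) \<subseteq> group_words K X" "W g \<in> group_words K X" using gs W(1) g by auto
    hence "KP K (map (list_mult K) (map W gs)) (list_mult K (W g)) \<longleftrightarrow>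
        BKP K (map (list_mult K) (map W gs)) (list_mult K (W g)) (nat (poly q (int ?N)))"
      using q unfolding knapsack_bounded_by_def Let_def by blast
    hence "BKP K gs g (nat (poly q (int ?N)))" using KP unfolding eq by simp
    thus "BKP K gs g (nat (poly r (int n)))"
    proof (rule BKP_mono)
      show "nat (poly q (int ?N)) \<le> nat (poly r (int n))"
        using r(2)[of "int ?N" "int n"] N by simp
    qed
  qed
  ultimately show ?thesis using that X r(1) by blast
qed


section \<open>Evaluation of words and stacks\<close>

context two_groups
begin

abbreviation letters :: "('a + 'b) set" where
  "letters \<equiv> Inl ` carrier G \<union> Inr ` carrier H"

abbreviation nontrivial :: "('a + 'b) set" where
  "nontrivial \<equiv> fp_letters G H"

abbreviation push :: "'a + 'b \<Rightarrow> ('a + 'b) list \<Rightarrow> ('a + 'b) list" where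
  "push \<equiv> fp_cons G H"

definition eval :: "('a + 'b) list \<Rightarrow> ('a + 'b) list" where
  "eval w = foldr push w []"

lemma eval_simps [simp]: "eval [] = []" "eval (x # w) = push x (eval w)"
  by (simp_all add: eval_def)

lemma eval_closed: "set w \<subseteq> letters \<Longrightarrow> eval w \<in> fp_reduced G H"
  unfolding eval_def by (rule fp_mult_closed) auto

lemma eval_append: "eval (u @ w) = foldr push u (eval w)"
  by (simp add: eval_def)

lemma eval_reduced: "w \<in> fp_reduced G H \<Longrightarrow> eval w = w"
  by (simp add: eval_def fp_mult_Nil)

lemma eval_append_mult:
  assumes "set u \<subseteq> letters" "set w \<subseteq> letters"
  shows "eval (u @ w) = foldr push (eval u) (eval w)"
  unfolding eval_append using fp_mult_assoc[of u "[]" "eval w"] assms eval_closed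
  by (simp add: eval_def)

lemma eval_cong:
  assumes "eval u = eval u'" "set u \<subseteq> letters" "set u' \<subseteq> letters" "set w \<subseteq> letters"
  shows "eval (u @ w) = eval (u' @ w)"
  using assms by (simp add: eval_append_mult)

lemma nontrivial_letters: "l \<in> nontrivial \<Longrightarrow> l \<in> letters"
  by (auto simp: fp_letters_def)

lemma push_cases:
  assumes "l \<in> letters" "s \<in> fp_reduced G H"
  obtains (trivial) "l \<notin> nontrivial" "push l s = s"
    | (new) "l \<in> nontrivial" "s = [] \<or> isl (hd s) \<noteq> isl l" "push l s = l # s"
    | (pop) a t where "l \<in> nontrivial" "s = a # t" "isl a = isl l" "push l s = t"
    | (change) a b t where "l \<in> nontrivial" "s = a # t" "isl a = isl l" "push l s = b # t"
        "isl b = isl l" "b \<noteq> a"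
proof (cases "l \<in> nontrivial")
  case False
  hence "l = Inl \<one>\<^bsub>G\<^esub> \<or> l = Inr \<one>\<^bsub>H\<^esub>" using assms(1) by (auto simp: fp_letters_def)
  hence "push l s = s" using fp_cons_one[OF assms(2)] by auto
  thus ?thesis using trivial False by blast
next
  case nt: True
  show ?thesis
  proof (cases "s = [] \<or> isl (hd s) \<noteq> isl l")
    case True
    hence "push l s = l # s" using nt
      by (cases l) (auto simp: fp_cons_isl fp_cons_not_isl fp_letters_def)
    thus ?thesis using new nt True by blast
  next
    case False
    then obtain a t where s: "s = a # t" "isl a = isl l" by (cases s) auto
    have a: "a \<in> nontrivial" using assms(2) s by (simp add: Cons_fp_reduced_iff)
    show ?thesis
    proof (cases l)
      case (Inl x)
      then obtain y where y: "a = Inl y" using s by (cases a) auto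
      have xy: "x \<in> carrier G" "x \<noteq> \<one>\<^bsub>G\<^esub>" "y \<in> carrier G" using nt a Inl y by (auto simp: fp_letters_def)
      have "x \<otimes>\<^bsub>G\<^esub> y \<noteq> y" using xy G.r_cancel_one by auto
      thus ?thesis using pop[OF nt s] change[OF nt s, of "Inl (x \<otimes>\<^bsub>G\<^esub> y)"] Inl y s
        by (cases "x \<otimes>\<^bsub>G\<^esub> y = \<one>\<^bsub>G\<^esub>") auto
    next
      case (Inr x)
      then obtain y where y: "a = Inr y" using s by (cases a) auto
      have xy: "x \<in> carrier H" "x \<noteq> \<one>\<^bsub>H\<^esub>" "y \<in> carrier H" using nt a Inr y by (auto simp: fp_letters_def)
      have "x \<otimes>\<^bsub>H\<^esub> y \<noteq> y" using xy H.r_cancel_one by auto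
      thus ?thesis using pop[OF nt s] change[OF nt s, of "Inr (x \<otimes>\<^bsub>H\<^esub> y)"] Inr y s
        by (cases "x \<otimes>\<^bsub>H\<^esub> y = \<one>\<^bsub>H\<^esub>") auto
    qed
  qed
qed

text \<open>
  Read from right to left, a word operates on a stack, which holds the reduced form of the part
  read so far.  A letter changes only the top entry.  So a nonempty stack that stays at the
  bottom is first reached, and first left, by a letter from the factor of its top entry.
\<close>

lemma push_reaches:
  assumes "l \<in> letters" "s \<in> fp_reduced G H" "p \<noteq> []" "suffix p (push l s)" "\<not> suffix p s"
  shows "push l s = p" "isl (hd p) = isl l" "l \<in> nontrivial"
  using push_cases[OF assms(1,2)] assms(3-5)
  by (cases rule: push_cases[OF assms(1,2)]; force simp: suffix_Cons)+

lemma push_leaves: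
  assumes "l \<in> letters" "s \<in> fp_reduced G H" "p \<noteq> []" "suffix p s" "\<not> suffix p (push l s)"
  shows "s = p" "isl (hd p) = isl l" "l \<in> nontrivial"
  using assms(3-5)
  by (cases rule: push_cases[OF assms(1,2)]; force simp: suffix_Cons)+

lemma push_destroys:
  assumes "l \<in> nontrivial" "s \<in> fp_reduced G H" "s \<noteq> []" "isl (hd s) = isl l"
  shows "\<not> suffix s (push l s)"
  using assms(1,3,4) nontrivial_letters[OF assms(1)]
  by (cases rule: push_cases[OF nontrivial_letters[OF assms(1)] assms(2)])
    (auto dest: suffix_length_le simp: suffix_Cons)

text \<open>
  An arc joins two letters that act on the same stack entry with no letter in between acting on
  it or below: \<open>y\<close> leaves an entry on top of the stack, and \<open>x < y\<close>, which is read later, acts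
  on it.
\<close>

definition arc :: "('a + 'b) list \<Rightarrow> nat \<Rightarrow> nat \<Rightarrow> bool" where
  "arc W x y \<longleftrightarrow> x < y \<and> y < length W \<and> W ! x \<in> nontrivial \<and> W ! y \<in> nontrivial \<and>
     eval (drop (Suc x) W) = eval (drop y W) \<and> eval (drop y W) \<noteq> [] \<and>
     isl (hd (eval (drop y W))) = isl (W ! x) \<and> isl (W ! y) = isl (W ! x) \<and>
     (\<forall>z. x < z \<and> z \<le> y \<longrightarrow> suffix (eval (drop y W)) (eval (drop z W)))"

lemma eval_drop_step:
  "z < length W \<Longrightarrow> eval (drop z W) = push (W ! z) (eval (drop (Suc z) W))"
  by (simp flip: Cons_nth_drop_Suc)

lemma eval_drop_closed: "set W \<subseteq> letters \<Longrightarrow> eval (drop z W) \<in> fp_reduced G H"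
  using set_drop_subset[of z W] by (intro eval_closed) auto

text \<open>
  If \<open>x\<close> acts on an entry that is already there, the last letter read before \<open>x\<close> that acted on
  it is the other end.  If \<open>x\<close> creates an entry, this entry has to disappear again, so a first
  letter read after \<open>x\<close> acts on it.
\<close>

lemma arc_exists:
  assumes W: "set W \<subseteq> letters" "eval W = []" and x: "x < length W" "W ! x \<in> nontrivial"
  shows "(\<exists>y. arc W x y) \<or> (\<exists>y. arc W y x)"
proof -
  define s where "s z = eval (drop z W)" for z
  have red: "s z \<in> fp_reduced G H" for z unfolding s_def using W(1) by (rule eval_drop_closed)
  have step: "s z = push (W ! z) (s (Suc z))" if "z < length W" for z
    unfolding s_def using that by (rule eval_drop_step)
  have let_W: "W ! z \<in> letters" if "z < length W" for z using W(1) nth_mem[OF that] by blast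
  have s_end: "s (length W) = []" "s 0 = []" using W(2) by (auto simp: s_def)
  show ?thesis
  proof (cases "s (Suc x) \<noteq> [] \<and> isl (hd (s (Suc x))) = isl (W ! x)")
    case True
    let ?p = "s (Suc x)"
    \<comment> \<open>\<open>y\<close> is the last index up to which the stack keeps \<open>s (Suc x)\<close> at the bottom\<close>
    let ?P = "\<lambda>y. Suc x \<le> y \<and> \<not> suffix ?p (s y)"
    have "?P (length W)" using True s_end x by auto
    hence ex: "\<exists>y. ?P y" ..
    define y0 where "y0 = (LEAST y. ?P y)"
    have y0: "?P y0" using LeastI_ex[OF ex] unfolding y0_def .
    have min: "\<not> ?P y" if "y < y0" for y using not_less_Least[OF that[unfolded y0_def]] .
    have "y0 \<noteq> Suc x" using y0 by auto
    then obtain y where y: "y0 = Suc y" "x < y" using y0 by (cases y0) auto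
    have suf: "suffix ?p (s z)" if "x < z" "z \<le> y" for z using min[of z] that y by auto
    have yl: "y < length W"
    proof (rule ccontr)
      assume "\<not> y < length W"
      hence "s y = []" by (simp add: s_def)
      thus False using suf[of y] y True by auto
    qed
    have *: "suffix ?p (push (W ! y) (s (Suc y)))" "\<not> suffix ?p (s (Suc y))"
      using suf[of y] y y0 step[OF yl] by auto
    have "s y = ?p" "isl (hd ?p) = isl (W ! y)" "W ! y \<in> nontrivial"
      using push_reaches[OF let_W[OF yl] red _ *] True step[OF yl] by auto
    hence "arc W x y" unfolding arc_def s_def[symmetric] using True x yl y suf by auto
    thus ?thesis by blast
  next
    case False
    let ?p = "s x"
    \<comment> \<open>\<open>x\<close> creates a new top entry; it is touched first where the stack stops containing \<open>s x\<close>\<close>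
    have px: "?p = W ! x # s (Suc x)"
      unfolding step[OF x(1)]
      by (rule push_cases[OF let_W[OF x(1)] red[of "Suc x"]]) (use False x(2) in simp_all)
    let ?P = "\<lambda>k. k \<le> x \<and> \<not> suffix ?p (s (x - k))"
    have "?P x" using s_end px by auto
    hence ex: "\<exists>k. ?P k" ..
    define k0 where "k0 = (LEAST k. ?P k)"
    have k0: "?P k0" using LeastI_ex[OF ex] unfolding k0_def .
    have min: "\<not> ?P k" if "k < k0" for k using not_less_Least[OF that[unfolded k0_def]] .
    define y where "y = x - k0"
    have k: "k0 \<noteq> 0" using k0 by (intro notI) auto
    hence yx: "y < x" using k0 by (auto simp: y_def)
    hence yl: "y < length W" using x by simp
    have suf: "suffix ?p (s z)" if "y < z" "z \<le> x" for z
      using min[of "x - z"] that k0 by (auto simp: y_def)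
    have *: "suffix ?p (s (Suc y))" "\<not> suffix ?p (push (W ! y) (s (Suc y)))"
      using suf[of "Suc y"] yx k0 step[OF yl] by (auto simp: y_def)
    have "s (Suc y) = ?p" "isl (hd ?p) = isl (W ! y)" "W ! y \<in> nontrivial"
      using push_leaves[OF let_W[OF yl] red _ *] px by auto
    hence "arc W y x" unfolding arc_def s_def[symmetric] using x yx suf px by auto
    thus ?thesis by blast
  qed
qed

text \<open>
  While the entry of the first arc waits, the stack never falls below it.  If \<open>y'\<close> were read
  before \<open>y\<close>, the same would hold for the second arc, so both would wait for the same entry, and
  \<open>x'\<close> would act on it inside the first arc.
\<close>

lemma arcs_noncrossing:
  assumes W: "set W \<subseteq> letters" and arcs: "arc W x y" "arc W x' y'" and between: "x < x'" "x' < y"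
  shows "y' \<le> y"
proof (rule ccontr)
  assume "\<not> y' \<le> y"
  define s where "s z = eval (drop z W)" for z
  note a = arcs(1)[unfolded arc_def s_def[symmetric]]
  note a' = arcs(2)[unfolded arc_def s_def[symmetric]]
  have x': "x' < length W" using a' by simp
  have "suffix (s y) (s x')" "suffix (s y) (s (Suc x'))" using a between by auto
  moreover have "suffix (s y') (s y)" using a' between \<open>\<not> y' \<le> y\<close> by auto
  hence "suffix (s (Suc x')) (s y)" using a' by simp
  ultimately have eq: "s (Suc x') = s y" by (metis suffix_order.antisym)
  have "\<not> suffix (s (Suc x')) (push (W ! x') (s (Suc x')))"
    using a' unfolding s_def by (intro push_destroys eval_drop_closed W) auto
  hence "\<not> suffix (s y) (s x')" using eq eval_drop_step[OF x'] by (simp add: s_def)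
  thus False using \<open>suffix (s y) (s x')\<close> by simp
qed

end

section \<open>Words with exponents and their pumping property\<close>

definition pow_word :: "'s list \<Rightarrow> nat \<Rightarrow> 's list" where
  "pow_word u n = concat (replicate n u)"

lemma pow_word_simps [simp]:
  "pow_word u 0 = []" "pow_word u (Suc n) = u @ pow_word u n" "pow_word [] n = []"
  by (induction n) (simp_all add: pow_word_def)

lemma pow_word_add: "pow_word u (m + n) = pow_word u m @ pow_word u n"
  by (induction m) simp_all

lemma set_pow_word: "set (pow_word u n) \<subseteq> set u"
  by (induction n) auto

lemma length_pow_word [simp]: "length (pow_word u n) = n * length u"
  by (induction n) simp_all

lemma map_pow_word: "map f (pow_word u n) = pow_word (map f u) n"
  by (induction n) simp_all

text \<open>
  The segment \<open>(v, c, u, d)\<close> stands for \<open>c\<close>, followed by the power of \<open>u\<close> with exponent variable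
  \<open>v\<close>, followed by \<open>d\<close>.
\<close>

type_synonym 's segment = "nat \<times> 's list \<times> 's list \<times> 's list"

definition expand :: "(nat \<Rightarrow> nat) \<Rightarrow> 's segment list \<Rightarrow> 's list" where
  "expand \<sigma> S = concat (map (\<lambda>(v, c, u, d). c @ pow_word u (\<sigma> v) @ d) S)"

definition symbols :: "'s segment list \<Rightarrow> 's list" where
  "symbols S = concat (map (\<lambda>(v, c, u, d). c @ u @ d) S)"

lemma expand_simps [simp]:
  "expand \<sigma> [] = []"
  "expand \<sigma> ((v, c, u, d) # S) = c @ pow_word u (\<sigma> v) @ d @ expand \<sigma> S"
  by (simp_all add: expand_def)

lemma symbols_simps [simp]:
  "symbols [] = []" "symbols ((v, c, u, d) # S) = c @ u @ d @ symbols S"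
  by (simp_all add: symbols_def)

lemma expand_append: "expand \<sigma> (S @ T) = expand \<sigma> S @ expand \<sigma> T"
  by (simp add: expand_def)

lemma set_expand: "set (expand \<sigma> S) \<subseteq> set (symbols S)"
proof (induction S)
  case (Cons s S)
  obtain v c u d where "s = (v, c, u, d)" by (cases s)
  thus ?case using Cons set_pow_word[of u "\<sigma> v"] by auto
qed simp

lemma expand_cong: "(\<And>v. v \<in> fst ` set S \<Longrightarrow> \<sigma> v = \<sigma>' v) \<Longrightarrow> expand \<sigma> S = expand \<sigma>' S"
  by (induction S) auto

lemma skip_prefix:
  assumes "A @ x # C = P @ Z" "x \<notin> set P"
  obtains A' where "A = P @ A'" "A' @ x # C = Z"
proof -
  from assms(1) obtain us where "A = P @ us \<and> us @ x # C = Z \<or> A @ us = P \<and> x # C = us @ Z"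
    by (auto simp: append_eq_append_conv2)
  thus ?thesis
  proof
    assume "A @ us = P \<and> x # C = us @ Z"
    thus ?thesis using assms(2) that[of "[]"] by (cases us) auto
  qed (use that in blast)
qed

lemma second_occurrence:
  assumes "A @ x # B @ x # C = P @ x # Z" "x \<notin> set P"
  shows "x \<in> set Z"
proof -
  obtain A' where "A' @ x # B @ x # C = x # Z" using skip_prefix[OF assms] by blast
  thus ?thesis by (cases A') auto
qed

lemma occurrence_in_pow_word:
  assumes "A @ x # C = pow_word (u1 @ x # u2) e @ R"
    and "x \<notin> set u1" "x \<notin> set u2" "x \<notin> set R"
  shows "\<exists>a b. e = Suc (a + b) \<and> A = pow_word (u1 @ x # u2) a @ u1 \<and>
    C = u2 @ pow_word (u1 @ x # u2) b @ R"
  using assms(1)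
proof (induction e arbitrary: A)
  case 0
  hence "x \<in> set R" by (metis pow_word_simps(1) append_Nil in_set_conv_decomp)
  thus ?case using assms(4) by simp
next
  case (Suc e)
  let ?u = "u1 @ x # u2"
  have "A @ x # C = u1 @ (x # u2 @ pow_word ?u e @ R)" using Suc.prems by simp
  from skip_prefix[OF this assms(2)] obtain A1
    where A1: "A = u1 @ A1" "A1 @ x # C = x # u2 @ pow_word ?u e @ R" .
  show ?case
  proof (cases A1)
    case Nil
    thus ?thesis using A1 by (intro exI[of _ 0] exI[of _ e]) simp
  next
    case (Cons y A2)
    hence "A2 @ x # C = u2 @ pow_word ?u e @ R" "y = x" using A1(2) by simp_all
    from skip_prefix[OF this(1) assms(3)] obtain A3
      where A3: "A2 = u2 @ A3" "A3 @ x # C = pow_word ?u e @ R" .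
    from Suc.IH[OF A3(2)] obtain a b where "e = Suc (a + b)" "A3 = pow_word ?u a @ u1"
      "C = u2 @ pow_word ?u b @ R" by blast
    thus ?thesis using A1(1) A3(1) Cons \<open>y = x\<close>
      by (intro exI[of _ "Suc a"] exI[of _ b]) simp
  qed
qed

text \<open>
  If the symbols of the segments are distinct, then a symbol can occur twice only inside one
  power, at the same place of two periods.  The part between the two occurrences is a number of
  full periods (up to a cyclic shift), so deleting it only lowers an exponent.
\<close>

lemma expand_pump:
  assumes "distinct (symbols S)" "distinct (map fst S)"
    and "expand \<sigma> S = A @ x # B @ x # C"
  shows "\<exists>\<sigma>'. expand \<sigma>' S = A @ x # C \<and> (\<forall>v. \<sigma>' v \<le> \<sigma> v) \<and> (\<exists>v \<in> fst ` set S. \<sigma>' v < \<sigma> v) \<and>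
    (\<forall>v. v \<notin> fst ` set S \<longrightarrow> \<sigma>' v = \<sigma> v)"
  using assms
proof (induction S arbitrary: A)
  case Nil
  thus ?case by simp
next
  case (Cons s S)
  obtain v c u d where s: "s = (v, c, u, d)" by (cases s)
  let ?E = "expand \<sigma> S"
  have v: "v \<notin> fst ` set S" using Cons.prems(2) s by simp
  have dist: "distinct (c @ u @ d @ symbols S)" using Cons.prems(1) s by simp
  have eq: "A @ x # B @ x # C = c @ pow_word u (\<sigma> v) @ d @ ?E"
    using Cons.prems(3) s by simp
  have E: "x \<notin> set ?E" if "x \<notin> set (symbols S)" using set_expand[of \<sigma> S] that by blast
  have pow: "x \<notin> set (pow_word u (\<sigma> v))" if "x \<notin> set u" using set_pow_word[of u] that by blast
  consider "x \<in> set c" | "x \<in> set d" "x \<notin> set c" | "x \<in> set u" "x \<notin> set c" "x \<notin> set d"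
    | "x \<notin> set c" "x \<notin> set u" "x \<notin> set d" by blast
  thus ?case
  proof cases
    case 1
    then obtain c1 c2 where c: "c = c1 @ x # c2" by (meson split_list)
    have "x \<in> set (c2 @ pow_word u (\<sigma> v) @ d @ ?E)"
      by (rule second_occurrence[of A x B C c1]) (use eq c dist in auto)
    moreover have "x \<notin> set (c2 @ u @ d @ symbols S)" using dist c by auto
    ultimately show ?thesis using E pow by auto
  next
    case 2
    then obtain d1 d2 where d: "d = d1 @ x # d2" by (meson split_list)
    have "x \<notin> set c" "x \<notin> set u" "x \<notin> set d1" "x \<notin> set (d2 @ symbols S)"
      using dist d by auto
    moreover have "x \<in> set (d2 @ ?E)"
      by (rule second_occurrence[of A x B C "c @ pow_word u (\<sigma> v) @ d1"])
        (use eq d calculation pow in auto)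
    ultimately show ?thesis using E by auto
  next
    case 3
    then obtain u1 u2 where u: "u = u1 @ x # u2" by (meson split_list)
    have x: "x \<notin> set u1" "x \<notin> set u2" "x \<notin> set (d @ ?E)" using dist u E by auto
    from skip_prefix[OF eq 3(2)] obtain A1
      where A1: "A = c @ A1" "A1 @ x # B @ x # C = pow_word u (\<sigma> v) @ d @ ?E" .
    from occurrence_in_pow_word[OF A1(2)[unfolded u] x] obtain a b
      where a: "\<sigma> v = Suc (a + b)" "A1 = pow_word u a @ u1"
        "B @ x # C = u2 @ pow_word u b @ d @ ?E" unfolding u by blast
    from skip_prefix[OF a(3) x(2)] obtain B1
      where "B1 @ x # C = pow_word u b @ d @ ?E" by blast
    from occurrence_in_pow_word[OF this[unfolded u] x] obtain a' b'
      where b: "b = Suc (a' + b')" "C = u2 @ pow_word u b' @ d @ ?E" unfolding u by blast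
    define \<sigma>' where "\<sigma>' = \<sigma>(v := Suc (a + b'))"
    have "expand \<sigma>' S = ?E" using v by (intro expand_cong) (auto simp: \<sigma>'_def)
    hence "expand \<sigma>' (s # S) = c @ pow_word u (a + Suc b') @ d @ ?E" by (simp add: s \<sigma>'_def)
    also have "\<dots> = A @ x # C"
      unfolding pow_word_add using A1(1) a(2) b(2) by (simp add: u)
    finally have "expand \<sigma>' (s # S) = A @ x # C" .
    moreover have "\<sigma>' w \<le> \<sigma> w" "w \<noteq> v \<Longrightarrow> \<sigma>' w = \<sigma> w" "\<sigma>' v < \<sigma> v" for w
      using a(1) b(1) by (auto simp: \<sigma>'_def)
    ultimately show ?thesis using s by (intro exI[of _ \<sigma>']) auto
  next
    case 4
    have "A @ x # B @ x # C = (c @ pow_word u (\<sigma> v) @ d) @ ?E" using eq by simp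
    from skip_prefix[OF this] 4 pow obtain A1
      where A1: "A = (c @ pow_word u (\<sigma> v) @ d) @ A1" "A1 @ x # B @ x # C = ?E" by auto
    from Cons.IH[OF _ _ A1(2)[symmetric]] Cons.prems(1,2) s obtain \<sigma>'
      where "expand \<sigma>' S = A1 @ x # C" "\<And>w. \<sigma>' w \<le> \<sigma> w" "\<exists>w \<in> fst ` set S. \<sigma>' w < \<sigma> w"
        "\<And>w. w \<notin> fst ` set S \<Longrightarrow> \<sigma>' w = \<sigma> w" by auto
    thus ?thesis using A1(1) v s by (intro exI[of _ \<sigma>']) auto
  qed
qed

section \<open>Exponents of cyclically reduced words\<close>

context two_groups
begin

lemma reduced_append: "u @ w \<in> fp_reduced G H \<Longrightarrow> u \<in> fp_reduced G H \<and> w \<in> fp_reduced G H"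
  by (auto simp: fp_reduced_def successively_append_iff)

lemma reduced_pow_word:
  assumes "u @ u \<in> fp_reduced G H"
  shows "pow_word u n \<in> fp_reduced G H"
proof (cases "u = []")
  case False
  show ?thesis
  proof (induction n)
    case (Suc n)
    have "pow_word u n = [] \<or> hd (pow_word u n) = hd u" using False by (cases n) auto
    thus ?case using assms Suc False by (auto simp: fp_reduced_def successively_append_iff)
  qed simp
qed simp

lemma eval_left_cancel:
  assumes "set u \<subseteq> letters" "set w \<subseteq> letters" "eval (u @ w) = eval w"
  shows "eval u = []"
proof -
  interpret F: group "free_product G H" by (rule group_free_product)
  have "foldr push (eval u) (eval w) = eval w" using assms by (simp add: eval_append_mult)
  thus ?thesis
    using F.r_cancel_one[of "eval w" "eval u"] eval_closed[OF assms(1)] eval_closed[OF assms(2)]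
    by simp
qed

text \<open>Two equal values would make the nonempty reduced word between the two positions trivial.\<close>

lemma reduced_factor_prefix_values:
  assumes V: "V \<in> fp_reduced G H" and B: "set B \<subseteq> letters"
    and ij: "i < j" "j \<le> length V"
  shows "eval (drop i V @ B) \<noteq> eval (drop j V @ B)"
proof
  assume eq: "eval (drop i V @ B) = eval (drop j V @ B)"
  define U where "U = take (j - i) (drop i V)"
  have split: "drop i V = U @ drop j V"
    unfolding U_def using ij by (metis append_take_drop_id drop_drop le_add_diff_inverse2 less_imp_le)
  have "take i V @ drop i V \<in> fp_reduced G H" using V by simp
  hence red: "U \<in> fp_reduced G H" "drop j V \<in> fp_reduced G H"
    unfolding split using reduced_append by blast+
  have "eval U = []"
    by (rule eval_left_cancel[of _ "drop j V @ B"])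
      (use red B eq split fp_reduced_letters in auto)
  moreover have "length U = j - i" using ij by (simp add: U_def)
  ultimately show False using eval_reduced[OF red(1)] ij by auto
qed

text \<open>
  The part under the inner arc and the part under the outer arc both have value \<open>1\<close>.  So the two
  parts between the arcs are inverse to each other and can be deleted together.
\<close>

lemma eval_cut_nested:
  assumes letters: "set (A @ a # B @ a # M @ b # D @ b # E) \<subseteq> letters"
    and outer: "eval (B @ a # M @ b # D @ b # E) = eval (b # E)"
    and inner: "eval (M @ b # D @ b # E) = eval (b # D @ b # E)"
  shows "eval (A @ a # M @ b # E) = eval (A @ a # B @ a # M @ b # D @ b # E)"
proof -
  have "eval M = []" by (rule eval_left_cancel[OF _ _ inner]) (use letters in auto)
  hence "eval (M @ b # E) = eval (b # E)"
    using eval_cong[of M "[]" "b # E"] letters by simp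
  also have "\<dots> = eval (B @ a # M @ b # D @ b # E)" using outer ..
  finally have "eval (a # M @ b # E) = eval (a # B @ a # M @ b # D @ b # E)"
    unfolding eval_simps by (rule arg_cong)
  thus ?thesis unfolding eval_append[of A] by (rule arg_cong)
qed

lemma split_at_two_positions:
  assumes "p < q" "q < length w"
  shows "w = take p w @ w ! p # take (q - Suc p) (drop (Suc p) w) @ w ! q # drop (Suc q) w"
proof -
  have "drop (q - Suc p) (drop (Suc p) w) = drop q w" using assms by (simp add: drop_drop)
  hence "drop (Suc p) w = take (q - Suc p) (drop (Suc p) w) @ drop q w"
    by (metis append_take_drop_id)
  thus ?thesis using assms
    by (metis Cons_nth_drop_Suc append_take_drop_id less_trans)
qed

lemma nested_arcs_cut:
  fixes \<phi> :: "'s \<Rightarrow> 'a + 'b"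
  assumes \<phi>: "\<phi> ` set (symbols S) \<subseteq> letters"
    and dist: "distinct (symbols S)" "distinct (map fst S)"
    and w: "w = expand \<sigma> S"
    and arcs: "arc (map \<phi> w) p q" "arc (map \<phi> w) p' q'"
    and nested: "p < p'" "p' < q'" "q' < q"
    and same: "w ! p = w ! p'" "w ! q = w ! q'"
  shows "\<exists>\<sigma>'. eval (map \<phi> (expand \<sigma>' S)) = eval (map \<phi> w) \<and>
    (\<forall>v. \<sigma>' v \<le> \<sigma> v) \<and> (\<exists>v \<in> fst ` set S. \<sigma>' v < \<sigma> v)"
proof -
  have q: "q < length w" using arcs(1) by (simp add: arc_def)
  define a b where "a = w ! p" and "b = w ! q"
  define A E where "A = take p w" and "E = drop (Suc q) w"
  define B where "B = take (p' - Suc p) (drop (Suc p) w)"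
  define M where "M = take (q' - Suc p') (drop (Suc p') w)"
  define D where "D = take (q - Suc q') (drop (Suc q') w)"
  have w1: "w = A @ a # B @ a # drop (Suc p') w"
    using split_at_two_positions[of p p' w] nested q same by (simp add: A_def B_def a_def)
  have w2: "drop (Suc q') w = D @ b # E" "drop q' w = b # D @ b # E" "drop q w = b # E"
  proof -
    have sp: "w = take q' w @ w ! q' # D @ b # E"
      using split_at_two_positions[of q' q w] nested q same by (simp add: D_def E_def b_def)
    show "drop (Suc q') w = D @ b # E" "drop q' w = b # D @ b # E"
      using arg_cong[OF sp, of "drop (Suc q')"] arg_cong[OF sp, of "drop q'"] nested q same b_def
      by simp_all
    show "drop q w = b # E" using q by (simp add: b_def E_def Cons_nth_drop_Suc)
  qed
  have w3: "drop (Suc p') w = M @ b # D @ b # E"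
  proof -
    have "w = take p' w @ w ! p' # M @ w ! q' # drop (Suc q') w"
      using split_at_two_positions[of p' q' w] nested q by (simp add: M_def)
    from arg_cong[OF this, of "drop (Suc p')"] show ?thesis
      using nested q same w2(1) b_def by simp
  qed
  have weq: "w = A @ a # B @ a # M @ b # D @ b # E" using w1 w3 by simp
  have w4: "drop (Suc p) w = B @ a # M @ b # D @ b # E"
    using arg_cong[OF weq, of "drop (Suc p)"] nested q by (simp add: A_def)
  have W: "set (map \<phi> w) \<subseteq> letters" using set_expand[of \<sigma> S] \<phi> w by auto
  let ?f = "map \<phi>"
  have cut: "eval (?f (A @ a # M @ b # E)) = eval (?f w)"
  proof -
    have "eval (?f A @ \<phi> a # ?f M @ \<phi> b # ?f E) =
        eval (?f A @ \<phi> a # ?f B @ \<phi> a # ?f M @ \<phi> b # ?f D @ \<phi> b # ?f E)"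
    proof (rule eval_cut_nested)
      show "set (?f A @ \<phi> a # ?f B @ \<phi> a # ?f M @ \<phi> b # ?f D @ \<phi> b # ?f E) \<subseteq> letters"
        using W weq by simp
      have "eval (?f (drop (Suc p) w)) = eval (?f (drop q w))"
        using arcs(1) by (simp add: arc_def drop_map)
      thus "eval (?f B @ \<phi> a # ?f M @ \<phi> b # ?f D @ \<phi> b # ?f E) = eval (\<phi> b # ?f E)"
        unfolding w4 w2 by simp
      have "eval (?f (drop (Suc p') w)) = eval (?f (drop q' w))"
        using arcs(2) by (simp add: arc_def drop_map)
      thus "eval (?f M @ \<phi> b # ?f D @ \<phi> b # ?f E) = eval (\<phi> b # ?f D @ \<phi> b # ?f E)"
        unfolding w3 w2 by simp
    qed
    thus ?thesis using weq by simp
  qed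
  have "expand \<sigma> S = A @ a # B @ a # (M @ b # D @ b # E)" using w weq by simp
  from expand_pump[OF dist this] obtain \<sigma>1 where \<sigma>1: "expand \<sigma>1 S = A @ a # M @ b # D @ b # E"
    "\<And>v. \<sigma>1 v \<le> \<sigma> v" "\<exists>v \<in> fst ` set S. \<sigma>1 v < \<sigma> v" by auto
  have "expand \<sigma>1 S = (A @ a # M) @ b # D @ b # E" using \<sigma>1(1) by simp
  from expand_pump[OF dist this] obtain \<sigma>2 where \<sigma>2: "expand \<sigma>2 S = (A @ a # M) @ b # E"
    "\<And>v. \<sigma>2 v \<le> \<sigma>1 v" by auto
  have "expand \<sigma>2 S = A @ a # M @ b # E" using \<sigma>2(1) by simp
  moreover have "\<sigma>2 v \<le> \<sigma> v" for v using \<sigma>1(2)[of v] \<sigma>2(2)[of v] by simp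
  moreover have "\<exists>v \<in> fst ` set S. \<sigma>2 v < \<sigma> v" using \<sigma>1(3) \<sigma>2(2) le_less_trans by blast
  ultimately show ?thesis using cut by (intro exI[of _ \<sigma>2]) simp
qed

text \<open>
  In a solution with least exponent sum, mark one letter in each period of a cyclically reduced
  power.  Each marked letter is joined by an arc to another letter, which lies outside the power
  since the power is reduced.  If there are more periods than pairs of a direction and a symbol,
  then the arcs of two marked letters go in the same direction to occurrences of the same
  symbol.  They do not cross, so they are nested, and cutting between them gives a solution with
  smaller exponents.
\<close>

lemma minimal_solution_bound:
  fixes \<phi> :: "'s \<Rightarrow> 'a + 'b"
  assumes \<phi>: "\<phi> ` set (symbols S) \<subseteq> letters"
    and dist: "distinct (symbols S)" "distinct (map fst S)"
    and sol: "eval (map \<phi> (expand \<sigma> S)) = []"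
    and min: "\<And>\<sigma>'. eval (map \<phi> (expand \<sigma>' S)) = [] \<Longrightarrow> sum \<sigma> (fst ` set S) \<le> sum \<sigma>' (fst ` set S)"
    and seg: "(v, c, u, d) \<in> set S" "u \<noteq> []" "map \<phi> u @ map \<phi> u \<in> fp_reduced G H"
  shows "\<sigma> v \<le> 2 * length (symbols S)"
proof (rule ccontr)
  assume large: "\<not> \<sigma> v \<le> 2 * length (symbols S)"
  define e where "e = \<sigma> v"
  define w where "w = expand \<sigma> S"
  define W where "W = map \<phi> w"
  define s where "s z = eval (drop z W)" for z
  from seg(1) obtain S1 S2 where S: "S = S1 @ (v, c, u, d) # S2" by (meson split_list)
  define A where "A = expand \<sigma> S1 @ c"
  define B where "B = d @ expand \<sigma> S2"
  define V where "V = pow_word (map \<phi> u) e"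
  have w: "w = A @ pow_word u e @ B" by (simp add: w_def S expand_append A_def B_def e_def)
  have W: "W = map \<phi> A @ V @ map \<phi> B" by (simp add: W_def w V_def map_pow_word)
  have W_letters: "set W \<subseteq> letters" using set_expand[of \<sigma> S] \<phi> by (auto simp: W_def w_def)
  have V: "V \<in> fp_reduced G H" unfolding V_def using seg(3) by (rule reduced_pow_word)
  let ?m = "length A"
  let ?n = "length A + length V"
  have drop_W: "drop z W = drop (z - ?m) V @ map \<phi> B" if "?m \<le> z" "z \<le> ?n" for z
    using that by (simp add: W)
  have distinct_s: "s z \<noteq> s z'" if "?m \<le> z" "z < z'" "z' \<le> ?n" for z z'
    unfolding s_def using that drop_W[of z] drop_W[of z'] W_letters
      reduced_factor_prefix_values[OF V, of "map \<phi> B" "z - ?m" "z' - ?m"]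
    by (simp add: W)
  have alternate: "isl (W ! z) \<noteq> isl (W ! Suc z)" if "?m \<le> z" "Suc z < ?n" for z
  proof -
    from that(1) obtain i where i: "z = ?m + i" by (auto simp: le_iff_add)
    have "isl (V ! i) \<noteq> isl (V ! Suc i)"
      using V that(2) i by (simp add: fp_reduced_def successively_conv_nth)
    moreover have "W ! (?m + j) = V ! j" if "j < length V" for j
      using that by (simp add: W nth_append)
    from this[of i] this[of "Suc i"] have "W ! z = V ! i" "W ! Suc z = V ! Suc i"
      using that(2) by (simp_all add: i)
    ultimately show ?thesis by simp
  qed
  \<comment> \<open>the part under such an arc would be empty, but adjacent letters come from different factors\<close>
  have no_inner: False if "arc W x y" "?m \<le> x" "y < ?n" for x y
  proof -
    have xy: "x < y" "s (Suc x) = s y" "isl (W ! y) = isl (W ! x)"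
      using that(1) by (auto simp: arc_def s_def)
    show False
    proof (cases "y = Suc x")
      case True
      thus ?thesis using alternate[of x] xy that by simp
    next
      case False
      thus ?thesis using distinct_s[of "Suc x" y] xy that by simp
    qed
  qed
  define pos where "pos t = ?m + t * length u" for t
  have pos_less: "pos t < ?n" "?m \<le> pos t" if "t < e" for t
    using that seg(2) by (simp_all add: pos_def V_def)
  have pos_mono: "pos t < pos t'" if "t < t'" for t t' using that seg(2) by (simp add: pos_def)
  have w_pos: "w ! pos t = hd u" if "t < e" for t
  proof -
    from less_imp_Suc_add[OF that] obtain k where "e = t + Suc k" by auto
    hence "pow_word u e = pow_word u t @ u @ pow_word u k"
      by (simp only: pow_word_add pow_word_simps)
    thus ?thesis using seg(2) by (simp add: w pos_def nth_append hd_conv_nth)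
  qed
  have lenW: "length W = length w" "?n \<le> length w" by (simp_all add: W_def w V_def)
  have nontriv: "W ! pos t \<in> nontrivial" if "t < e" for t
  proof -
    from pos_less[OF that] obtain i where i: "pos t = ?m + i" "i < length V"
      by (auto simp: le_iff_add)
    hence "V ! i \<in> nontrivial" using V nth_mem[OF i(2)] unfolding fp_reduced_def by blast
    thus ?thesis using i by (simp add: W nth_append)
  qed
  have "\<forall>t \<in> {..<e}. \<exists>f. if fst f then arc W (pos t) (snd f) else arc W (snd f) (pos t)"
  proof
    fix t assume "t \<in> {..<e}"
    hence t: "t < e" by simp
    have "(\<exists>y. arc W (pos t) y) \<or> (\<exists>y. arc W y (pos t))"
      using arc_exists[OF W_letters _ _ nontriv[OF t]] sol pos_less[OF t] lenW
      by (simp add: W_def w_def)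
    thus "\<exists>f. if fst f then arc W (pos t) (snd f) else arc W (snd f) (pos t)"
      by (metis fst_conv snd_conv)
  qed
  from bchoice[OF this] obtain f where f: "\<And>t. t < e \<Longrightarrow>
      if fst (f t) then arc W (pos t) (snd (f t)) else arc W (snd (f t)) (pos t)" by auto
  define colour where "colour t = (fst (f t), w ! snd (f t))" for t
  have "colour ` {..<e} \<subseteq> UNIV \<times> set (symbols S)"
  proof
    fix k assume "k \<in> colour ` {..<e}"
    then obtain t where t: "t < e" "k = colour t" by auto
    have "snd (f t) < length w" using f[OF t(1)] lenW by (auto simp: arc_def split: if_splits)
    hence "w ! snd (f t) \<in> set (symbols S)" using set_expand[of \<sigma> S] nth_mem by (auto simp: w_def)
    thus "k \<in> UNIV \<times> set (symbols S)" by (simp add: t(2) colour_def)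
  qed
  moreover have "card (UNIV \<times> set (symbols S) :: (bool \<times> 's) set) = 2 * length (symbols S)"
    using dist(1) by (simp add: card_cartesian_product distinct_card)
  moreover have "finite (UNIV \<times> set (symbols S) :: (bool \<times> 's) set)" by simp
  ultimately have "card (colour ` {..<e}) \<le> 2 * length (symbols S)" by (metis card_mono)
  hence "\<not> inj_on colour {..<e}" using large by (auto simp: e_def dest: card_image)
  then obtain t t' where tt: "t < t'" "t' < e" "colour t = colour t'"
    unfolding inj_on_def by (metis lessThan_iff linorder_neqE_nat)
  define x x' y y' where "x = pos t" and "x' = pos t'" and "y = snd (f t)" and "y' = snd (f t')"
  have x: "?m \<le> x" "x < x'" "x' < ?n" using tt pos_less pos_mono by (auto simp: x_def x'_def)
  have wx: "w ! x = w ! x'" using tt w_pos by (simp add: x_def x'_def)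
  have wy: "w ! y = w ! y'" using tt(3) by (simp add: colour_def y_def y'_def)
  have "\<exists>p q p' q'. arc W p q \<and> arc W p' q' \<and> p < p' \<and> p' < q' \<and> q' < q \<and>
      w ! p = w ! p' \<and> w ! q = w ! q'"
  proof (cases "fst (f t)")
    case True
    hence arcs: "arc W x y" "arc W x' y'"
      using f[of t] f[of t'] tt by (auto simp: colour_def x_def x'_def y_def y'_def)
    have "x' < y" using no_inner[OF arcs(1)] x by (meson le_less_trans not_le_imp_less)
    hence "y' \<le> y" using arcs_noncrossing[OF W_letters arcs] x by simp
    moreover have "y' \<noteq> y" using distinct_s[of "Suc x" "Suc x'"] x arcs by (auto simp: arc_def s_def)
    moreover have "x' < y'" using arcs(2) by (simp add: arc_def)
    ultimately show ?thesis using arcs x wx wy by (meson le_neq_implies_less)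
  next
    case False
    hence arcs: "arc W y x" "arc W y' x'"
      using f[of t] f[of t'] tt by (auto simp: colour_def x_def x'_def y_def y'_def)
    have "y' < x" using no_inner[OF arcs(2)] x by (meson le_trans not_le_imp_less)
    have "y' \<noteq> y" using distinct_s[of x x'] x arcs by (auto simp: arc_def s_def)
    moreover have "\<not> y < y'"
    proof
      assume "y < y'"
      thus False using arcs_noncrossing[OF W_letters arcs] \<open>y' < x\<close> x by simp
    qed
    moreover have "y < x" using arcs(1) by (simp add: arc_def)
    ultimately show ?thesis using arcs x wx wy by (metis linorder_neqE_nat)
  qed
  then obtain p q p' q' where "arc (map \<phi> w) p q" "arc (map \<phi> w) p' q'" "p < p'" "p' < q'" "q' < q"
    "w ! p = w ! p'" "w ! q = w ! q'" by (auto simp: W_def)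
  from nested_arcs_cut[OF \<phi> dist w_def this] obtain \<sigma>' where
    \<sigma>': "eval (map \<phi> (expand \<sigma>' S)) = eval (map \<phi> w)" "\<And>v. \<sigma>' v \<le> \<sigma> v"
    "\<exists>v \<in> fst ` set S. \<sigma>' v < \<sigma> v" by blast
  have "sum \<sigma>' (fst ` set S) < sum \<sigma> (fst ` set S)"
    using \<sigma>'(2,3) by (intro sum_strict_mono_ex1) auto
  thus False using min[of \<sigma>'] \<sigma>'(1) sol by (simp add: w_def)
qed

end

section \<open>Products with constants and powers in one factor\<close>

text \<open>
  An item \<open>(a, None)\<close> is a constant; an item \<open>(a, Some v)\<close> is a power of \<open>a\<close> whose exponent is
  the variable \<open>v\<close>.
\<close>

type_synonym 'c items = "('c \<times> nat option) list"

definition item_val :: "('c, 'm) monoid_scheme \<Rightarrow> (nat \<Rightarrow> nat) \<Rightarrow> 'c \<times> nat option \<Rightarrow> 'c" where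
  "item_val K \<sigma> i = (case snd i of None \<Rightarrow> fst i | Some v \<Rightarrow> fst i [^]\<^bsub>K\<^esub> \<sigma> v)"

definition item_prod :: "('c, 'm) monoid_scheme \<Rightarrow> (nat \<Rightarrow> nat) \<Rightarrow> 'c items \<Rightarrow> 'c" where
  "item_prod K \<sigma> xs = list_mult K (map (item_val K \<sigma>) xs)"

definition item_vars :: "'c items \<Rightarrow> nat list" where
  "item_vars xs = List.map_filter snd xs"

definition item_size :: "('c \<Rightarrow> nat) \<Rightarrow> 'c items \<Rightarrow> nat" where
  "item_size nu xs = (\<Sum>i\<leftarrow>xs. Suc (nu (fst i)))"

lemma item_simps [simp]:
  "item_prod K \<sigma> [] = \<one>\<^bsub>K\<^esub>" "item_prod K \<sigma> (i # xs) = item_val K \<sigma> i \<otimes>\<^bsub>K\<^esub> item_prod K \<sigma> xs"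
  "item_val K \<sigma> (a, None) = a" "item_val K \<sigma> (a, Some v) = a [^]\<^bsub>K\<^esub> \<sigma> v"
  "item_vars [] = []" "item_vars ((a, None) # xs) = item_vars xs"
  "item_vars ((a, Some v) # xs) = v # item_vars xs"
  "item_size nu [] = 0" "item_size nu ((a, e) # xs) = Suc (nu a) + item_size nu xs"
  by (simp_all add: item_prod_def item_val_def item_vars_def item_size_def map_filter_simps)

lemma item_vars_append: "item_vars (xs @ js) = item_vars xs @ item_vars js"
  by (simp add: item_vars_def map_filter_def)

lemma item_size_append: "item_size nu (xs @ js) = item_size nu xs + item_size nu js"
  by (simp add: item_size_def)

lemma item_prod_cong:
  assumes "\<And>v. v \<in> set (item_vars xs) \<Longrightarrow> \<sigma> v = \<sigma>' v"
  shows "item_prod K \<sigma> xs = item_prod K \<sigma>' xs"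
  using assms
proof (induction xs)
  case (Cons i xs)
  obtain a e where i: "i = (a, e)" by (cases i)
  show ?case using Cons by (cases e) (auto simp: i)
qed simp

lemma (in group) item_val_closed: "fst i \<in> carrier G \<Longrightarrow> item_val G \<sigma> i \<in> carrier G"
  by (simp add: item_val_def split: option.split)

lemma (in group) item_prod_closed:
  "fst ` set xs \<subseteq> carrier G \<Longrightarrow> item_prod G \<sigma> xs \<in> carrier G"
  by (induction xs) (auto simp: item_val_closed)

lemma (in group) item_prod_append:
  "fst ` set xs \<subseteq> carrier G \<Longrightarrow> fst ` set js \<subseteq> carrier G \<Longrightarrow>
    item_prod G \<sigma> (xs @ js) = item_prod G \<sigma> xs \<otimes> item_prod G \<sigma> js"
  by (induction xs) (auto simp: item_val_closed item_prod_closed m_assoc)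

lemma (in group) conjugate_pow:
  assumes "c \<in> carrier G" "a \<in> carrier G"
  shows "(c \<otimes> a \<otimes> inv c) [^] (n::nat) = c \<otimes> a [^] n \<otimes> inv c"
proof (induction n)
  case (Suc n)
  have "inv c \<otimes> (c \<otimes> (a \<otimes> inv c)) = a \<otimes> inv c"
    using assms by (simp flip: m_assoc)
  thus ?case using Suc assms by (simp add: m_assoc)
qed (use assms in simp)

text \<open>
  Constants are moved to the right end, which conjugates the bases of the powers:
  \<open>c \<otimes> a [^] n = (c \<otimes> a \<otimes> inv c) [^] n \<otimes> c\<close>.
\<close>

fun knapsack_form :: "('c, 'm) monoid_scheme \<Rightarrow> 'c \<Rightarrow> 'c items \<Rightarrow> 'c list \<times> 'c" where
  "knapsack_form K c [] = ([], c)"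
| "knapsack_form K c ((a, None) # xs) = knapsack_form K (c \<otimes>\<^bsub>K\<^esub> a) xs"
| "knapsack_form K c ((a, Some v) # xs) =
     (let (bs, d) = knapsack_form K c xs in (c \<otimes>\<^bsub>K\<^esub> a \<otimes>\<^bsub>K\<^esub> inv\<^bsub>K\<^esub> c # bs, d))"

lemma knapsack_prod_Cons [simp]:
  "knapsack_prod K (g # gs) (e # es) = g [^]\<^bsub>K\<^esub> e \<otimes>\<^bsub>K\<^esub> knapsack_prod K gs es"
  by (simp add: knapsack_prod_def)

lemma knapsack_prod_Nil [simp]: "knapsack_prod K [] es = \<one>\<^bsub>K\<^esub>"
  by (simp add: knapsack_prod_def)

lemma (in group) knapsack_prod_closed:
  "set gs \<subseteq> carrier G \<Longrightarrow> length es = length gs \<Longrightarrow> knapsack_prod G gs es \<in> carrier G"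
  by (induction gs es rule: list_induct2') auto

lemma (in group) knapsack_form_correct:
  assumes "c \<in> carrier G" "fst ` set xs \<subseteq> carrier G" "knapsack_form G c xs = (bs, d)"
  shows "set bs \<subseteq> carrier G \<and> d \<in> carrier G \<and> length bs = length (item_vars xs) \<and>
    c \<otimes> item_prod G \<sigma> xs = knapsack_prod G bs (map \<sigma> (item_vars xs)) \<otimes> d"
  using assms
proof (induction xs arbitrary: c bs d)
  case (Cons i xs)
  obtain a e where i: "i = (a, e)" by (cases i)
  have a: "a \<in> carrier G" and xs: "fst ` set xs \<subseteq> carrier G" using Cons.prems(2) i by auto
  note closed = item_prod_closed[OF xs]
  show ?case
  proof (cases e)
    case None
    thus ?thesis using Cons.IH[of "c \<otimes> a" bs d] Cons.prems a xs i closed by (simp add: m_assoc)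
  next
    case (Some v)
    obtain bs' d' where form: "knapsack_form G c xs = (bs', d')" by fastforce
    from Cons.IH[OF Cons.prems(1) xs form]
    have IH: "set bs' \<subseteq> carrier G" "d' \<in> carrier G" "length bs' = length (item_vars xs)"
      "c \<otimes> item_prod G \<sigma> xs = knapsack_prod G bs' (map \<sigma> (item_vars xs)) \<otimes> d'" by auto
    have bs: "bs = (c \<otimes> a \<otimes> inv c) # bs'" "d = d'" using Cons.prems(3) i Some form by simp_all
    let ?k = "knapsack_prod G bs' (map \<sigma> (item_vars xs))"
    have k: "?k \<in> carrier G" using knapsack_prod_closed[OF IH(1)] IH(3) by simp
    have "c \<otimes> (a [^] \<sigma> v \<otimes> item_prod G \<sigma> xs)
        = (c \<otimes> a [^] \<sigma> v \<otimes> inv c) \<otimes> (c \<otimes> item_prod G \<sigma> xs)"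
      using Cons.prems(1) a closed by (metis (no_types, lifting) inv_closed inv_solve_left m_assoc m_closed nat_pow_closed)
    also have "\<dots> = ((c \<otimes> a \<otimes> inv c) [^] \<sigma> v \<otimes> ?k) \<otimes> d'"
      unfolding IH(4) conjugate_pow[OF Cons.prems(1) a]
      using Cons.prems(1) a k IH(2) by (simp add: m_assoc)
    finally show ?thesis using IH Cons.prems(1) a bs i Some by simp
  qed
qed auto

text \<open>
  Every base is conjugated by a product of constants of size at most \<open>M\<close>, which adds at most
  \<open>2 * M\<close> to its size.
\<close>

lemma (in normed_knapsack_group) knapsack_form_size:
  assumes "c \<in> carrier K" "fst ` set xs \<subseteq> carrier K" "knapsack_form K c xs = (bs, d)"
    and "nu c + item_size nu xs \<le> M"
  shows "sum_list (map nu bs) + nu d \<le> (2 * M + 1) * item_size nu xs + nu c"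
  using assms
proof (induction xs arbitrary: c bs d)
  case (Cons i xs)
  obtain a e where i: "i = (a, e)" by (cases i)
  have a: "a \<in> carrier K" and xs: "fst ` set xs \<subseteq> carrier K" using Cons.prems(2) i by auto
  have expand: "(2 * M + 1) * item_size nu (i # xs)
      = (2 * M + 1) * item_size nu xs + (2 * M + 1) + (2 * M + 1) * nu a"
    by (simp add: i algebra_simps)
  have nu_a: "nu a \<le> (2 * M + 1) * nu a" by simp
  show ?case
  proof (cases e)
    case None
    have "nu (c \<otimes> a) \<le> nu c + nu a" using Cons.prems(1) a by (rule nu_mult)
    moreover from this have "sum_list (map nu bs) + nu d \<le> (2 * M + 1) * item_size nu xs + nu (c \<otimes> a)"
      using Cons.prems a xs i None by (intro Cons.IH) auto
    ultimately show ?thesis unfolding expand using nu_a by linarith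
  next
    case (Some v)
    obtain bs' d' where form: "knapsack_form K c xs = (bs', d')" by fastforce
    have bs: "bs = (c \<otimes> a \<otimes> inv c) # bs'" "d = d'" using Cons.prems(3) i Some form by simp_all
    have "sum_list (map nu bs') + nu d' \<le> (2 * M + 1) * item_size nu xs + nu c"
      using Cons.prems i by (intro Cons.IH[OF Cons.prems(1) xs form]) simp
    moreover have "nu (c \<otimes> a \<otimes> inv c) \<le> nu c + nu a + nu c"
      using nu_mult[of "c \<otimes> a" "inv c"] nu_mult[of c a] nu_inv[of c] Cons.prems(1) a by simp
    moreover have "nu c \<le> M" using Cons.prems(4) by simp
    ultimately show ?thesis unfolding expand using nu_a bs by simp
  qed
qed auto

lemma (in normed_knapsack_group) bounded_items:
  assumes "fst ` set xs \<subseteq> carrier K" "distinct (item_vars xs)"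
    and "item_size nu xs \<le> M" "item_prod K \<sigma> xs = \<one>"
  shows "\<exists>\<sigma>'. (\<forall>v. \<sigma>' v \<le> Q ((2 * M + 1) * M)) \<and> item_prod K \<sigma>' xs = \<one>"
proof -
  obtain bs d where form: "knapsack_form K \<one> xs = (bs, d)" by fastforce
  let ?vs = "item_vars xs"
  note correct = knapsack_form_correct[OF one_closed assms(1) form]
  have bs: "set bs \<subseteq> carrier K" "d \<in> carrier K" "length bs = length ?vs" using correct by auto
  have prod: "item_prod K \<tau> xs = \<one> \<longleftrightarrow> inv d = knapsack_prod K bs (map \<tau> ?vs)" for \<tau>
  proof -
    have "item_prod K \<tau> xs = knapsack_prod K bs (map \<tau> ?vs) \<otimes> d"
      using correct[of \<tau>] item_prod_closed[OF assms(1)] by simp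
    moreover have "knapsack_prod K bs (map \<tau> ?vs) \<in> carrier K"
      using knapsack_prod_closed[OF bs(1)] bs(3) by simp
    ultimately show ?thesis using bs(2) by (metis inv_equality inv_inv l_inv inv_closed)
  qed
  have "KP K bs (inv d)" unfolding KP_def
    using prod[of \<sigma>] assms(4) bs(3) by (intro exI[of _ "map \<sigma> ?vs"]) simp
  moreover have "sum_list (map nu bs) + nu (inv d) \<le> (2 * M + 1) * M"
  proof -
    have "sum_list (map nu bs) + nu d \<le> (2 * M + 1) * item_size nu xs + nu \<one>"
      using knapsack_form_size[OF one_closed assms(1) form] assms(3) by (simp add: nu_one)
    also have "\<dots> \<le> (2 * M + 1) * M" using assms(3) by (simp only: nu_one add_0_right mult_le_mono2)
    finally show ?thesis using nu_inv[OF bs(2)] by linarith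
  qed
  ultimately have "BKP K bs (inv d) (Q ((2 * M + 1) * M))"
    using bounded bs by simp
  then obtain es where es: "length es = length bs" "\<forall>e \<in> set es. e \<le> Q ((2 * M + 1) * M)"
    "inv d = knapsack_prod K bs es" unfolding BKP_def by blast
  define \<sigma>' where "\<sigma>' v = (case map_of (zip ?vs es) v of None \<Rightarrow> 0 | Some e \<Rightarrow> e)" for v
  have "map \<sigma>' ?vs = es"
    using assms(2) es(1) bs(3) by (intro nth_equalityI) (simp_all add: \<sigma>'_def map_of_zip_nth)
  hence "item_prod K \<sigma>' xs = \<one>" using prod[of \<sigma>'] es(3) by simp
  moreover have "\<sigma>' v \<le> Q ((2 * M + 1) * M)" for v
    using es(2) by (auto simp: \<sigma>'_def split: option.split dest!: map_of_SomeD set_zip_rightD)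
  ultimately show ?thesis by blast
qed


section \<open>Elliptic powers\<close>

locale two_normed_knapsack_groups = two_groups G H +
    G: normed_knapsack_group G nu Q + H: normed_knapsack_group H nu' Q'
  for G :: "('a, 'm) monoid_scheme" and H :: "('b, 'n) monoid_scheme"
    and nu :: "'a \<Rightarrow> nat" and Q :: "nat \<Rightarrow> nat" and nu' :: "'b \<Rightarrow> nat" and Q' :: "nat \<Rightarrow> nat"
begin

text \<open>A block is a letter of the free product whose value in its factor depends on the exponent variables.\<close>

type_synonym ('c, 'd) block = "'c items + 'd items"

definition block_letter :: "(nat \<Rightarrow> nat) \<Rightarrow> ('a, 'b) block \<Rightarrow> 'a + 'b" where
  "block_letter \<sigma> = map_sum (item_prod G \<sigma>) (item_prod H \<sigma>)"

definition block_vars :: "('a, 'b) block \<Rightarrow> nat list" where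
  "block_vars = case_sum item_vars item_vars"

definition block_size :: "('a, 'b) block \<Rightarrow> nat" where
  "block_size = case_sum (item_size nu) (item_size nu')"

definition blocks :: "('a, 'b) block set" where
  "blocks = Inl ` {xs. fst ` set xs \<subseteq> carrier G} \<union> Inr ` {xs. fst ` set xs \<subseteq> carrier H}"

text \<open>
  The argument of \<open>Q\<close> and \<open>Q'\<close> bounds the size of the knapsack form of a product of items of
  total size \<open>M\<close>.
\<close>

definition exponent_bound :: "nat \<Rightarrow> nat" where
  "exponent_bound M = Q ((2 * M + 1) * M) + Q' ((2 * M + 1) * M)"

lemma blocks_iff [simp]:
  "Inl xs \<in> blocks \<longleftrightarrow> fst ` set xs \<subseteq> carrier G" "Inr ys \<in> blocks \<longleftrightarrow> fst ` set ys \<subseteq> carrier H"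
  by (auto simp: blocks_def)

lemma block_letter_closed: "b \<in> blocks \<Longrightarrow> block_letter \<sigma> b \<in> letters"
  by (auto simp: blocks_def block_letter_def G.item_prod_closed H.item_prod_closed)

lemma block_letter_cong:
  "(\<And>v. v \<in> set (block_vars b) \<Longrightarrow> \<sigma> v = \<sigma>' v) \<Longrightarrow> block_letter \<sigma> b = block_letter \<sigma>' b"
  by (cases b) (auto simp: block_letter_def block_vars_def intro!: item_prod_cong)

lemma isl_block_letter [simp]: "isl (block_letter \<sigma> b) = isl b"
  by (cases b) (simp_all add: block_letter_def)

lemma bounded_trivial_block:
  assumes "b \<in> blocks" "distinct (block_vars b)" "block_size b \<le> M" "block_letter \<sigma> b \<notin> nontrivial"
  shows "\<exists>\<sigma>'. (\<forall>v. \<sigma>' v \<le> exponent_bound M) \<and> block_letter \<sigma>' b \<notin> nontrivial"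
proof (cases b)
  case (Inl xs)
  have "item_prod G \<sigma> xs = \<one>\<^bsub>G\<^esub>" and xs: "fst ` set xs \<subseteq> carrier G"
    using assms(1,4) Inl G.item_prod_closed by (auto simp: blocks_def block_letter_def fp_letters_def)
  with G.bounded_items[of xs M \<sigma>] assms(2,3) Inl obtain \<sigma>'
    where "\<And>v. \<sigma>' v \<le> Q ((2 * M + 1) * M)" "item_prod G \<sigma>' xs = \<one>\<^bsub>G\<^esub>"
    by (auto simp: block_vars_def block_size_def)
  thus ?thesis using Inl
    by (intro exI[of _ \<sigma>']) (auto simp: block_letter_def fp_letters_def exponent_bound_def intro: trans_le_add1)
next
  case (Inr xs)
  have "item_prod H \<sigma> xs = \<one>\<^bsub>H\<^esub>" and xs: "fst ` set xs \<subseteq> carrier H"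
    using assms(1,4) Inr H.item_prod_closed by (auto simp: blocks_def block_letter_def fp_letters_def)
  with H.bounded_items[of xs M \<sigma>] assms(2,3) Inr obtain \<sigma>'
    where "\<And>v. \<sigma>' v \<le> Q' ((2 * M + 1) * M)" "item_prod H \<sigma>' xs = \<one>\<^bsub>H\<^esub>"
    by (auto simp: block_vars_def block_size_def)
  thus ?thesis using Inr
    by (intro exI[of _ \<sigma>']) (auto simp: block_letter_def fp_letters_def exponent_bound_def intro: trans_le_add2)
qed

lemma eval_remove_trivial:
  assumes "set (A @ l # B) \<subseteq> letters" "l \<notin> nontrivial"
  shows "eval (A @ l # B) = eval (A @ B)"
proof -
  have "push l (eval B) = eval B"
    by (rule push_cases[of l "eval B"]) (use assms in \<open>auto intro: eval_closed\<close>)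
  thus ?thesis by (simp add: eval_append)
qed

lemma merge_blocks:
  assumes "b \<in> blocks" "b' \<in> blocks" "isl b = isl b'"
  obtains m where "m \<in> blocks" "block_vars m = block_vars b @ block_vars b'"
    "block_size m = block_size b + block_size b'"
    "\<And>\<sigma> A B. set A \<subseteq> blocks \<Longrightarrow> set B \<subseteq> blocks \<Longrightarrow>
      eval (map (block_letter \<sigma>) (A @ b # b' # B)) = eval (map (block_letter \<sigma>) (A @ m # B))"
proof -
  have closed: "eval (map (block_letter \<sigma>) B) \<in> fp_reduced G H" if "set B \<subseteq> blocks" for \<sigma> B
    using that block_letter_closed by (intro eval_closed) auto
  show ?thesis
  proof (cases b)
    case (Inl xs)
    then obtain js where js: "b' = Inl js" using assms(3) by (cases b') auto
    have c: "fst ` set xs \<subseteq> carrier G" "fst ` set js \<subseteq> carrier G"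
      using assms(1,2) Inl js by (auto simp: blocks_def)
    show ?thesis
    proof (rule that[of "Inl (xs @ js)"])
      fix \<sigma> A B assume "set (B :: ('a, 'b) block list) \<subseteq> blocks"
      from fp_cons_Inl_Inl[OF G.item_prod_closed[OF c(1)] G.item_prod_closed[OF c(2)] closed[OF this]]
      show "eval (map (block_letter \<sigma>) (A @ b # b' # B))
          = eval (map (block_letter \<sigma>) (A @ Inl (xs @ js) # B))"
        using c by (simp add: eval_append block_letter_def Inl js G.item_prod_append del: fp_cons.simps)
    qed (use c Inl js in \<open>simp_all add: image_Un block_vars_def block_size_def item_vars_append item_size_append\<close>)
  next
    case (Inr xs)
    then obtain js where js: "b' = Inr js" using assms(3) by (cases b') auto
    have c: "fst ` set xs \<subseteq> carrier H" "fst ` set js \<subseteq> carrier H"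
      using assms(1,2) Inr js by (auto simp: blocks_def)
    show ?thesis
    proof (rule that[of "Inr (xs @ js)"])
      fix \<sigma> A B assume "set (B :: ('a, 'b) block list) \<subseteq> blocks"
      from fp_cons_Inr_Inr[OF H.item_prod_closed[OF c(1)] H.item_prod_closed[OF c(2)] closed[OF this]]
      show "eval (map (block_letter \<sigma>) (A @ b # b' # B))
          = eval (map (block_letter \<sigma>) (A @ Inr (xs @ js) # B))"
        using c by (simp add: eval_append block_letter_def Inr js H.item_prod_append del: fp_cons.simps)
    qed (use c Inr js in \<open>simp_all add: image_Un block_vars_def block_size_def item_vars_append item_size_append\<close>)
  qed
qed

lemma not_successively_split:
  "\<not> successively P xs \<Longrightarrow> \<exists>ys x y zs. xs = ys @ x # y # zs \<and> \<not> P x y"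
proof (induction P xs rule: successively.induct)
  case (3 P x y xs)
  show ?case
  proof (cases "P x y")
    case True
    with 3 obtain ys a b zs where "y # xs = ys @ a # b # zs" "\<not> P a b" by auto
    thus ?thesis by (intro exI[of _ "x # ys"]) auto
  qed (intro exI[of _ "[]"], auto)
qed auto

text \<open>
  A nonempty word of value \<open>1\<close> is not reduced.  So some letter is trivial, which is a knapsack
  instance in one factor and can be solved and removed, or two adjacent letters belong to the
  same factor and are merged into one product.  As no variable occurs twice, the solutions for
  the removed letters can be chosen independently.
\<close>

lemma bounded_blocks:
  assumes "set T \<subseteq> blocks" "distinct (concat (map block_vars T))"
    and "sum_list (map block_size T) \<le> M" "eval (map (block_letter \<sigma>) T) = []"
  shows "\<exists>\<sigma>'. (\<forall>v. \<sigma>' v \<le> exponent_bound M) \<and> eval (map (block_letter \<sigma>') T) = []"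
  using assms
proof (induction "length T" arbitrary: T rule: less_induct)
  case less
  let ?W = "map (block_letter \<sigma>) T"
  have W: "set ?W \<subseteq> letters" using less.prems(1) block_letter_closed by auto
  consider "T = []" | "\<not> set ?W \<subseteq> nontrivial" | "T \<noteq> []" "\<not> successively (\<lambda>x y. isl x \<noteq> isl y) T"
  proof -
    have "T = []" if "?W \<in> fp_reduced G H" using eval_reduced[OF that] less.prems(4) by simp
    thus ?thesis using that by (auto simp: fp_reduced_def successively_map)
  qed
  thus ?case
  proof cases
    case 1
    thus ?thesis by (intro exI[of _ "\<lambda>_. 0"]) simp
  next
    case 2
    then obtain b where b: "b \<in> set T" "block_letter \<sigma> b \<notin> nontrivial" by auto
    from b(1) obtain A B where T: "T = A @ b # B" by (meson split_list)
    have "distinct (block_vars b)" "block_size b \<le> M" "b \<in> blocks" using less.prems T by auto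
    from bounded_trivial_block[OF this(3,1,2) b(2)] obtain \<sigma>1
      where \<sigma>1: "\<And>v. \<sigma>1 v \<le> exponent_bound M" "block_letter \<sigma>1 b \<notin> nontrivial" by auto
    have "eval (map (block_letter \<sigma>) (A @ B)) = []"
      using eval_remove_trivial[of "map (block_letter \<sigma>) A"] W less.prems(4) b(2) T by simp
    hence "\<exists>\<sigma>'. (\<forall>v. \<sigma>' v \<le> exponent_bound M) \<and> eval (map (block_letter \<sigma>') (A @ B)) = []"
      by (intro less.hyps) (use T less.prems in auto)
    then obtain \<sigma>2
      where \<sigma>2: "\<And>v. \<sigma>2 v \<le> exponent_bound M" "eval (map (block_letter \<sigma>2) (A @ B)) = []" by blast
    define \<sigma>' where "\<sigma>' v = (if v \<in> set (block_vars b) then \<sigma>1 v else \<sigma>2 v)" for v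
    have 1: "block_letter \<sigma>' b = block_letter \<sigma>1 b" by (rule block_letter_cong) (simp add: \<sigma>'_def)
    have 2: "map (block_letter \<sigma>') (A @ B) = map (block_letter \<sigma>2) (A @ B)"
    proof (rule map_cong[OF refl], rule block_letter_cong)
      fix b' v assume "b' \<in> set (A @ B)" "v \<in> set (block_vars b')"
      hence "v \<notin> set (block_vars b)" using less.prems(2) T by auto
      thus "\<sigma>' v = \<sigma>2 v" by (simp add: \<sigma>'_def)
    qed
    have "set (map (block_letter \<sigma>') A @ block_letter \<sigma>' b # map (block_letter \<sigma>') B) \<subseteq> letters"
    proof -
      have "block_letter \<sigma>' ` set T \<subseteq> letters"
        by (rule image_subsetI, rule block_letter_closed) (use less.prems(1) in blast)
      thus ?thesis by (simp add: T image_Un)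
    qed
    from eval_remove_trivial[OF this] 1 \<sigma>1(2)
    have "eval (map (block_letter \<sigma>') T) = eval (map (block_letter \<sigma>') (A @ B))"
      by (simp add: T)
    moreover have "\<sigma>' v \<le> exponent_bound M" for v using \<sigma>1(1) \<sigma>2(1) by (simp add: \<sigma>'_def)
    ultimately show ?thesis using 2 \<sigma>2(2) by metis
  next
    case 3
    from not_successively_split[OF 3(2)] obtain A b b' B
      where T: "T = A @ b # b' # B" "isl b = isl b'" by auto
    have blocks: "b \<in> blocks" "b' \<in> blocks" "set A \<subseteq> blocks" "set B \<subseteq> blocks"
      using less.prems(1) T by auto
    from merge_blocks[OF blocks(1,2) T(2)] obtain m where m: "m \<in> blocks"
      "block_vars m = block_vars b @ block_vars b'" "block_size m = block_size b + block_size b'"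
      "\<And>\<sigma> A B. set A \<subseteq> blocks \<Longrightarrow> set B \<subseteq> blocks \<Longrightarrow>
        eval (map (block_letter \<sigma>) (A @ b # b' # B)) = eval (map (block_letter \<sigma>) (A @ m # B))"
      by blast
    have "\<exists>\<sigma>'. (\<forall>v. \<sigma>' v \<le> exponent_bound M) \<and> eval (map (block_letter \<sigma>') (A @ m # B)) = []"
    proof (rule less.hyps)
      show "eval (map (block_letter \<sigma>) (A @ m # B)) = []"
        using less.prems(4) m(4)[OF blocks(3,4)] unfolding T by metis
    qed (use T less.prems blocks m in auto)
    thus ?thesis unfolding T m(4)[OF blocks(3,4)] .
  qed
qed

end

section \<open>Sizes, inverse words and conjugates of cyclically reduced words\<close>

context two_normed_knapsack_groups
begin

text \<open>Counting every letter with an extra \<open>1\<close> makes the size also an upper bound of the length.\<close>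

definition letter_size :: "'a + 'b \<Rightarrow> nat" where
  "letter_size = case_sum (\<lambda>a. Suc (nu a)) (\<lambda>b. Suc (nu' b))"

definition word_size :: "('a + 'b) list \<Rightarrow> nat" where
  "word_size w = sum_list (map letter_size w)"

definition inv_letter :: "'a + 'b \<Rightarrow> 'a + 'b" where
  "inv_letter = map_sum (m_inv G) (m_inv H)"

definition inv_word :: "('a + 'b) list \<Rightarrow> ('a + 'b) list" where
  "inv_word w = rev (map inv_letter w)"

abbreviation F :: "('a + 'b) list monoid" where
  "F \<equiv> free_product G H"

lemma word_size_simps [simp]:
  "word_size [] = 0" "word_size (x # w) = letter_size x + word_size w"
  "word_size (u @ w) = word_size u + word_size w"
  by (simp_all add: word_size_def)

lemma length_le_word_size: "length w \<le> word_size w"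
proof (induction w)
  case (Cons x w)
  thus ?case by (cases x) (auto simp: letter_size_def)
qed simp

lemma inv_word_simps [simp]: "inv_word [] = []" "inv_word (x # w) = inv_word w @ [inv_letter x]"
  by (simp_all add: inv_word_def)

lemma inv_letter_closed: "x \<in> letters \<Longrightarrow> inv_letter x \<in> letters"
  by (auto simp: inv_letter_def)

lemma inv_word_closed: "set w \<subseteq> letters \<Longrightarrow> set (inv_word w) \<subseteq> letters"
  unfolding inv_word_def set_rev set_map
  by (rule image_subsetI, rule inv_letter_closed) blast

lemma letter_size_inv: "x \<in> letters \<Longrightarrow> letter_size (inv_letter x) \<le> letter_size x"
  by (auto simp: inv_letter_def letter_size_def G.nu_inv H.nu_inv)

lemma word_size_inv: "set w \<subseteq> letters \<Longrightarrow> word_size (inv_word w) \<le> word_size w"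
proof (induction w)
  case (Cons x w)
  thus ?case using letter_size_inv[of x] by simp
qed simp

lemma word_size_push:
  assumes "l \<in> letters" "s \<in> fp_reduced G H"
  shows "word_size (push l s) \<le> letter_size l + word_size s"
proof (cases s)
  case Nil
  thus ?thesis by (cases l) auto
next
  case (Cons y t)
  have y: "y \<in> letters" using assms(2) Cons nontrivial_letters by (simp add: Cons_fp_reduced_iff)
  show ?thesis
  proof (cases l; cases y)
    fix a b assume "l = Inl a" "y = Inl b"
    thus ?thesis using G.nu_mult[of a b] assms(1) y Cons by (auto simp: letter_size_def)
  next
    fix a b assume "l = Inr a" "y = Inr b"
    thus ?thesis using H.nu_mult[of a b] assms(1) y Cons by (auto simp: letter_size_def)
  qed (use Cons in auto)
qed

lemma word_size_eval: "set w \<subseteq> letters \<Longrightarrow> word_size (eval w) \<le> word_size w"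
proof (induction w)
  case (Cons x w)
  thus ?case using word_size_push[OF _ eval_closed, of x w] by simp
qed simp

interpretation F: group F by (rule group_free_product)

lemma eval_append_F:
  "set u \<subseteq> letters \<Longrightarrow> set w \<subseteq> letters \<Longrightarrow> eval (u @ w) = eval u \<otimes>\<^bsub>F\<^esub> eval w"
  by (simp add: eval_append_mult)

lemma eval_closed_F: "set w \<subseteq> letters \<Longrightarrow> eval w \<in> carrier F"
  by (simp add: eval_closed)

lemma eval_inv_letter:
  assumes "x \<in> letters"
  shows "eval [inv_letter x, x] = []"
proof (cases x)
  case (Inl a)
  thus ?thesis using assms fp_cons_Inl_Inl[of "inv\<^bsub>G\<^esub> a" a "[]"]
    by (auto simp: inv_letter_def fp_cons_one simp del: fp_cons.simps)
next
  case (Inr a)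
  thus ?thesis using assms fp_cons_Inr_Inr[of "inv\<^bsub>H\<^esub> a" a "[]"]
    by (auto simp: inv_letter_def fp_cons_one simp del: fp_cons.simps)
qed

lemma eval_inv_word_left: "set w \<subseteq> letters \<Longrightarrow> eval (inv_word w @ w) = []"
proof (induction w)
  case (Cons x w)
  have x: "x \<in> letters" and w: "set w \<subseteq> letters" using Cons.prems by auto
  have "eval ([inv_letter x, x] @ w) = eval ([] @ w)"
    using eval_cong[of "[inv_letter x, x]" "[]" w] eval_inv_letter[OF x] inv_letter_closed[OF x] x w
    by (simp del: eval_simps(2))
  thus ?case using Cons.IH[OF w] by (simp add: eval_append)
qed simp

lemma eval_inv_word:
  assumes "set w \<subseteq> letters"
  shows "eval (inv_word w) = inv\<^bsub>F\<^esub> (eval w)"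
proof -
  have "eval (inv_word w) \<otimes>\<^bsub>F\<^esub> eval w = \<one>\<^bsub>F\<^esub>"
    using eval_inv_word_left[OF assms] eval_append_F[OF inv_word_closed[OF assms] assms] by simp
  thus ?thesis
    using F.inv_equality eval_closed_F[OF assms] eval_closed_F[OF inv_word_closed[OF assms]] by metis
qed

lemma eval_pow_word:
  assumes "set u \<subseteq> letters"
  shows "eval (pow_word u n) = eval u [^]\<^bsub>F\<^esub> n"
proof (induction n)
  case (Suc n)
  have "set (pow_word u n) \<subseteq> letters" using assms set_pow_word[of u n] by blast
  hence "eval (pow_word u (Suc n)) = eval u \<otimes>\<^bsub>F\<^esub> eval (pow_word u n)"
    unfolding pow_word_simps by (rule eval_append_F[OF assms])
  also have "\<dots> = eval u [^]\<^bsub>F\<^esub> Suc n"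
    unfolding Suc by (rule F.nat_pow_Suc2[OF eval_closed_F[OF assms], symmetric])
  finally show ?case .
qed simp

lemma eval_conjugate_pow:
  assumes "set c \<subseteq> letters" "set u \<subseteq> letters"
  shows "eval (c @ pow_word u n @ inv_word c) = eval (c @ u @ inv_word c) [^]\<^bsub>F\<^esub> n"
proof -
  have pw: "set (pow_word u n) \<subseteq> letters" using assms set_pow_word[of u n] by blast
  have inv: "set (inv_word c) \<subseteq> letters" using assms(1) by (rule inv_word_closed)
  have conj: "eval (c @ w @ inv_word c) = eval c \<otimes>\<^bsub>F\<^esub> eval w \<otimes>\<^bsub>F\<^esub> inv\<^bsub>F\<^esub> (eval c)"
    if w: "set w \<subseteq> letters" for w
  proof -
    have "eval (c @ w @ inv_word c) = eval c \<otimes>\<^bsub>F\<^esub> eval (w @ inv_word c)"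
      by (rule eval_append_F) (use assms(1) w inv in simp_all)
    also have "eval (w @ inv_word c) = eval w \<otimes>\<^bsub>F\<^esub> inv\<^bsub>F\<^esub> (eval c)"
      unfolding eval_append_F[OF w inv] eval_inv_word[OF assms(1)] ..
    also have "eval c \<otimes>\<^bsub>F\<^esub> (eval w \<otimes>\<^bsub>F\<^esub> inv\<^bsub>F\<^esub> (eval c)) = eval c \<otimes>\<^bsub>F\<^esub> eval w \<otimes>\<^bsub>F\<^esub> inv\<^bsub>F\<^esub> (eval c)"
      by (rule F.m_assoc[symmetric]) (intro F.inv_closed eval_closed_F assms(1) w)+
    finally show ?thesis .
  qed
  show ?thesis
    unfolding conj[OF pw] conj[OF assms(2)] eval_pow_word[OF assms(2)]
    by (rule F.conjugate_pow[symmetric]) (intro eval_closed_F assms)+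
qed

text \<open>
  A reduced word that is neither a single letter nor cyclically reduced begins and ends in the
  same factor.  Conjugation by its first letter either cancels both ends or merges them into one
  letter; in the latter case the result is cyclically reduced.
\<close>

lemma cyclically_reduced_conjugate:
  assumes "g \<in> fp_reduced G H"
  shows "\<exists>c u. set c \<subseteq> letters \<and> u \<in> fp_reduced G H \<and> (length u \<le> 1 \<or> u @ u \<in> fp_reduced G H) \<and>
    eval (c @ u @ inv_word c) = g \<and> word_size c + word_size u \<le> 2 * word_size g"
  using assms
proof (induction "length g" arbitrary: g rule: less_induct)
  case less
  show ?case
  proof (cases "length g \<le> 1 \<or> g @ g \<in> fp_reduced G H")
    case True
    thus ?thesis using less.prems eval_reduced by (intro exI[of _ "[]"] exI[of _ g]) auto
  next
    case False
    then obtain x h where g: "g = x # h" "h \<noteq> []" by (cases g) auto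
    then obtain m y where h: "h = m @ [y]" by (cases h rule: rev_cases) auto
    have red: "[x] \<in> fp_reduced G H" "m @ [y] \<in> fp_reduced G H" "m \<in> fp_reduced G H"
      using less.prems reduced_append[of "[x]" h] reduced_append[of m "[y]"] by (auto simp: g h)
    have xy: "x \<in> nontrivial" "y \<in> nontrivial" using less.prems by (auto simp: g h fp_reduced_def)
    hence xyl: "x \<in> letters" "y \<in> letters" using nontrivial_letters by auto
    have "isl (last g) = isl (hd g)"
      using False less.prems by (auto simp: fp_reduced_def successively_append_iff)
    hence ends: "isl y = isl x" by (simp add: g h)
    have "m \<noteq> []" using less.prems ends by (auto simp: g h fp_reduced_def)
    hence m: "m \<noteq> []" "isl (hd m) \<noteq> isl x" "isl (last m) \<noteq> isl y"
      using less.prems ends by (auto simp: g h fp_reduced_def successively_append_iff successively_Cons)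
    have m_letters: "set m \<subseteq> letters" using fp_reduced_letters[OF red(3)] .
    obtain z where z: "z \<in> letters" "isl z = isl x" "letter_size z \<le> letter_size y + letter_size x"
      "eval [z, inv_letter x] = [y]" "z \<notin> nontrivial \<Longrightarrow> inv_letter x = y"
    proof (cases x)
      case (Inl a)
      then obtain b where b: "y = Inl b" using ends by (cases y) auto
      have ab: "a \<in> carrier G" "b \<in> carrier G" "b \<noteq> \<one>\<^bsub>G\<^esub>" using xy Inl b by (auto simp: fp_letters_def)
      show ?thesis
      proof (rule that[of "Inl (b \<otimes>\<^bsub>G\<^esub> a)"])
        show "letter_size (Inl (b \<otimes>\<^bsub>G\<^esub> a)) \<le> letter_size y + letter_size x"
          using G.nu_mult[OF ab(2,1)] by (simp add: letter_size_def Inl b)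
        have "b \<otimes>\<^bsub>G\<^esub> a \<otimes>\<^bsub>G\<^esub> inv\<^bsub>G\<^esub> a = b" using ab by (simp add: G.m_assoc)
        thus "eval [Inl (b \<otimes>\<^bsub>G\<^esub> a), inv_letter x] = [y]"
          using fp_cons_Inl_Inl[of "b \<otimes>\<^bsub>G\<^esub> a" "inv\<^bsub>G\<^esub> a" "[]"] ab
          by (simp add: inv_letter_def Inl b fp_cons_not_isl del: fp_cons.simps)
        show "inv_letter x = y" if "Inl (b \<otimes>\<^bsub>G\<^esub> a) \<notin> nontrivial"
        proof -
          have "b \<otimes>\<^bsub>G\<^esub> a = \<one>\<^bsub>G\<^esub>" using that ab by (auto simp: fp_letters_def)
          thus ?thesis using G.inv_equality[of b a] ab by (simp add: inv_letter_def Inl b)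
        qed
      qed (use ab Inl in auto)
    next
      case (Inr a)
      then obtain b where b: "y = Inr b" using ends by (cases y) auto
      have ab: "a \<in> carrier H" "b \<in> carrier H" "b \<noteq> \<one>\<^bsub>H\<^esub>" using xy Inr b by (auto simp: fp_letters_def)
      show ?thesis
      proof (rule that[of "Inr (b \<otimes>\<^bsub>H\<^esub> a)"])
        show "letter_size (Inr (b \<otimes>\<^bsub>H\<^esub> a)) \<le> letter_size y + letter_size x"
          using H.nu_mult[OF ab(2,1)] by (simp add: letter_size_def Inr b)
        have "b \<otimes>\<^bsub>H\<^esub> a \<otimes>\<^bsub>H\<^esub> inv\<^bsub>H\<^esub> a = b" using ab by (simp add: H.m_assoc)
        thus "eval [Inr (b \<otimes>\<^bsub>H\<^esub> a), inv_letter x] = [y]"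
          using fp_cons_Inr_Inr[of "b \<otimes>\<^bsub>H\<^esub> a" "inv\<^bsub>H\<^esub> a" "[]"] ab
          by (simp add: inv_letter_def Inr b fp_cons_isl del: fp_cons.simps)
        show "inv_letter x = y" if "Inr (b \<otimes>\<^bsub>H\<^esub> a) \<notin> nontrivial"
        proof -
          have "b \<otimes>\<^bsub>H\<^esub> a = \<one>\<^bsub>H\<^esub>" using that ab by (auto simp: fp_letters_def)
          thus ?thesis using H.inv_equality[of b a] ab by (simp add: inv_letter_def Inr b)
        qed
      qed (use ab Inr in auto)
    qed
    show ?thesis
    proof (cases "z \<in> nontrivial")
      case True
      let ?u = "m @ [z]"
      have "?u \<in> fp_reduced G H" "?u @ ?u \<in> fp_reduced G H"
        using red(3) m z(2) ends True
        by (auto simp: fp_reduced_def successively_append_iff successively_Cons)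
      moreover have "eval ([x] @ ?u @ inv_word [x]) = g"
        using z(4) eval_reduced[OF less.prems] eval_reduced[of "[y]"] reduced_append[OF red(2)]
        unfolding g h by (simp add: eval_append)
      moreover have "word_size [x] + word_size ?u \<le> 2 * word_size g"
        using z(3) by (simp add: g h)
      ultimately show ?thesis using xyl
        by (intro exI[of _ "[x]"] exI[of _ ?u]) simp
    next
      case False
      hence y: "inv_letter x = y" using z(5) by blast
      have "length m < length g" by (simp add: g h)
      from less.hyps[OF this red(3)] obtain c u where IH: "set c \<subseteq> letters" "u \<in> fp_reduced G H"
        "length u \<le> 1 \<or> u @ u \<in> fp_reduced G H" "eval (c @ u @ inv_word c) = m"
        "word_size c + word_size u \<le> 2 * word_size m" by blast
      have letters: "set (c @ u @ inv_word c) \<subseteq> letters"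
        using IH(1) inv_word_closed[OF IH(1)] fp_reduced_letters[OF IH(2)] by simp
      have "eval ((c @ u @ inv_word c) @ [y]) = eval (m @ [y])"
        by (rule eval_cong) (use IH(4) eval_reduced[OF red(3)] letters m_letters xyl in auto)
      hence "eval ((x # c) @ u @ inv_word (x # c)) = g"
        using eval_reduced[OF less.prems] y unfolding g h by simp
      moreover have "word_size (x # c) + word_size u \<le> 2 * word_size g"
        using IH(5) by (simp add: g h)
      ultimately show ?thesis using IH xyl
        by (intro exI[of _ "x # c"] exI[of _ u]) auto
    qed
  qed
qed

end

section \<open>Bounded solutions of exponential equations\<close>

text \<open>
  The pumping argument needs distinct symbols, while a letter may occur many times in an
  equation; so every letter is paired with its position.
\<close>

fun number_symbols :: "nat \<Rightarrow> 's segment list \<Rightarrow> (nat \<times> 's) segment list" where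
  "number_symbols n [] = []"
| "number_symbols n ((v, c, u, d) # S) =
     (v, List.enumerate n c, List.enumerate (n + length c) u,
        List.enumerate (n + length c + length u) d) #
       number_symbols (n + length c + length u + length d) S"

lemma map_fst_number_symbols: "map fst (number_symbols n S) = map fst S"
  by (induction n S rule: number_symbols.induct) auto

lemma positions_number_symbols:
  "map fst (symbols (number_symbols n S)) = [n..<n + length (symbols S)]"
proof (induction n S rule: number_symbols.induct)
  case (2 n v c u d S)
  thus ?case
    using upt_add_eq_append[of n "n + length c + length u + length d" "length (symbols S)"]
      upt_add_eq_append[of n "n + length c + length u" "length d"]
      upt_add_eq_append[of n "n + length c" "length u"]
    by (simp add: add.assoc)
qed simp

lemma symbols_number_symbols: "map snd (symbols (number_symbols n S)) = symbols S"
  by (induction n S rule: number_symbols.induct) simp_all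

lemma expand_number_symbols: "map snd (expand \<sigma> (number_symbols n S)) = expand \<sigma> S"
  by (induction n S rule: number_symbols.induct) (simp_all add: map_pow_word)

lemma number_symbols_segment:
  "(v, c, u, d) \<in> set S \<Longrightarrow> \<exists>c' u' d'. (v, c', u', d') \<in> set (number_symbols n S) \<and> map snd u' = u"
proof (induction n S rule: number_symbols.induct)
  case (2 n v' c' u' d' S)
  show ?case
  proof (cases "(v, c, u, d) = (v', c', u', d')")
    case True
    have "map snd (List.enumerate (n + length c') u') = u" using True by simp
    thus ?thesis using True unfolding number_symbols.simps list.set by blast
  next
    case False
    hence "(v, c, u, d) \<in> set S" using 2(2) by auto
    from 2(1)[OF this] show ?thesis unfolding number_symbols.simps list.set by blast
  qed
qed simp

lemma (in two_groups) bounded_hyperbolic_exponents: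
  assumes letters: "set (symbols S) \<subseteq> letters" and dist: "distinct (map fst S)"
    and sol: "eval (expand \<sigma> S) = []"
  shows "\<exists>\<sigma>'. eval (expand \<sigma>' S) = [] \<and> (\<forall>v c u d. (v, c, u, d) \<in> set S \<longrightarrow> u \<noteq> [] \<longrightarrow>
    u @ u \<in> fp_reduced G H \<longrightarrow> \<sigma>' v \<le> 2 * length (symbols S))"
proof -
  define S' where "S' = number_symbols 0 S"
  define f where "f \<sigma>' = sum \<sigma>' (fst ` set S')" for \<sigma>' :: "nat \<Rightarrow> nat"
  define P where "P \<sigma>' \<longleftrightarrow> eval (expand \<sigma>' S) = []" for \<sigma>'
  have "P \<sigma>" using sol by (simp add: P_def)
  from ex_has_least_nat[of P, OF this, of f] obtain \<sigma>'
    where \<sigma>': "P \<sigma>'" "\<And>\<tau>. P \<tau> \<Longrightarrow> f \<sigma>' \<le> f \<tau>" by blast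
  have snd: "map snd (symbols S') = symbols S" "map snd (expand \<tau> S') = expand \<tau> S" for \<tau>
    by (simp_all only: S'_def symbols_number_symbols expand_number_symbols)
  have "set (map snd (symbols S')) \<subseteq> letters" unfolding snd by (rule letters)
  hence 1: "snd ` set (symbols S') \<subseteq> letters" by simp
  have "distinct (map fst (symbols S'))" unfolding S'_def positions_number_symbols by simp
  hence 2: "distinct (symbols S')" by (simp add: distinct_map)
  have 3: "distinct (map fst S')" unfolding S'_def map_fst_number_symbols by (rule dist)
  have 4: "length (symbols S') = length (symbols S)" using arg_cong[OF snd(1), of length] by simp
  have "\<sigma>' v \<le> 2 * length (symbols S)"
    if "(v, c, u, d) \<in> set S" "u \<noteq> []" "u @ u \<in> fp_reduced G H" for v c u d
  proof -
    from number_symbols_segment[OF that(1)] obtain c' u' d'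
      where u': "(v, c', u', d') \<in> set S'" "map snd u' = u" unfolding S'_def by blast
    have "\<sigma>' v \<le> 2 * length (symbols S')"
    proof (rule minimal_solution_bound[OF 1 2 3, where \<sigma> = \<sigma>' and v = v])
      show "eval (map snd (expand \<sigma>' S')) = []" using \<sigma>'(1) by (simp only: P_def snd)
      show "sum \<sigma>' (fst ` set S') \<le> sum \<tau> (fst ` set S')"
        if "eval (map snd (expand \<tau> S')) = []" for \<tau>
        using \<sigma>'(2)[of \<tau>] that by (simp only: P_def f_def snd)
      show "(v, c', u', d') \<in> set S'" by (rule u'(1))
      show "u' \<noteq> []" using that(2) u'(2) by auto
      show "map snd u' @ map snd u' \<in> fp_reduced G H" unfolding u'(2) by (rule that(3))
    qed
    thus ?thesis by (simp only: 4)
  qed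
  thus ?thesis using \<sigma>'(1) unfolding P_def by blast
qed

context two_normed_knapsack_groups
begin

abbreviation hyperbolic :: "('a + 'b) list \<Rightarrow> bool" where
  "hyperbolic u \<equiv> u \<noteq> [] \<and> u @ u \<in> fp_reduced G H"

definition const_block :: "'a + 'b \<Rightarrow> ('a, 'b) block" where
  "const_block = map_sum (\<lambda>a. [(a, None)]) (\<lambda>b. [(b, None)])"

definition power_block :: "nat \<Rightarrow> 'a + 'b \<Rightarrow> ('a, 'b) block" where
  "power_block v = map_sum (\<lambda>a. [(a, Some v)]) (\<lambda>b. [(b, Some v)])"

text \<open>Hyperbolic powers are written out with the exponents \<open>\<sigma>\<close>; elliptic exponents stay variable.\<close>

fun segment_blocks :: "(nat \<Rightarrow> nat) \<Rightarrow> ('a + 'b) segment list \<Rightarrow> ('a, 'b) block list" where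
  "segment_blocks \<sigma> [] = []"
| "segment_blocks \<sigma> ((v, c, u, d) # S) =
     map const_block c @
     (if hyperbolic u then map const_block (pow_word u (\<sigma> v)) else map (power_block v) u) @
     map const_block d @ segment_blocks \<sigma> S"

lemma block_letter_const: "x \<in> letters \<Longrightarrow> block_letter \<sigma> (const_block x) = x"
  by (auto simp: block_letter_def const_block_def)

lemma map_block_letter_const: "set w \<subseteq> letters \<Longrightarrow> map (block_letter \<sigma> \<circ> const_block) w = w"
  by (rule map_idI) (auto simp: block_letter_const[unfolded comp_def])

lemma const_block_simps [simp]:
  "x \<in> letters \<Longrightarrow> const_block x \<in> blocks" "block_vars (const_block x) = []"
  "block_size (const_block x) = letter_size x"
  by (cases x; auto simp: const_block_def block_vars_def block_size_def letter_size_def)+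

lemma power_block_simps [simp]:
  "x \<in> letters \<Longrightarrow> power_block v x \<in> blocks" "block_vars (power_block v x) = [v]"
  "block_size (power_block v x) = letter_size x"
  by (cases x; auto simp: power_block_def block_vars_def block_size_def letter_size_def)+

lemma push_power_block:
  assumes "x \<in> letters" "set R \<subseteq> letters"
  shows "push (block_letter \<sigma> (power_block v x)) (eval R) = eval (pow_word [x] (\<sigma> v) @ R)"
proof -
  have R: "eval R \<in> fp_reduced G H" using assms(2) by (rule eval_closed)
  show ?thesis
  proof (cases x)
    case (Inl a)
    have a: "a \<in> carrier G" using assms(1) Inl by auto
    have "push (Inl (a [^]\<^bsub>G\<^esub> n)) (eval R) = eval (pow_word [Inl a] n @ R)" for n :: nat
    proof (induction n)
      case (Suc n)
      have "push (Inl (a [^]\<^bsub>G\<^esub> Suc n)) (eval R) = push (Inl a) (push (Inl (a [^]\<^bsub>G\<^esub> n)) (eval R))"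
        using fp_cons_Inl_Inl[OF a _ R, of "a [^]\<^bsub>G\<^esub> n"] G.nat_pow_Suc2[OF a] a by simp
      thus ?case using Suc by simp
    qed (use fp_cons_one[OF R] in simp)
    thus ?thesis using a by (simp add: block_letter_def power_block_def Inl)
  next
    case (Inr a)
    have a: "a \<in> carrier H" using assms(1) Inr by auto
    have "push (Inr (a [^]\<^bsub>H\<^esub> n)) (eval R) = eval (pow_word [Inr a] n @ R)" for n :: nat
    proof (induction n)
      case (Suc n)
      have "push (Inr (a [^]\<^bsub>H\<^esub> Suc n)) (eval R) = push (Inr a) (push (Inr (a [^]\<^bsub>H\<^esub> n)) (eval R))"
        using fp_cons_Inr_Inr[OF a _ R, of "a [^]\<^bsub>H\<^esub> n"] H.nat_pow_Suc2[OF a] a by simp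
      thus ?case using Suc by simp
    qed (use fp_cons_one[OF R] in simp)
    thus ?thesis using a by (simp add: block_letter_def power_block_def Inr)
  qed
qed

definition segments_ok :: "('a + 'b) segment list \<Rightarrow> bool" where
  "segments_ok S \<longleftrightarrow> set (symbols S) \<subseteq> letters \<and>
     (\<forall>(v, c, u, d) \<in> set S. length u \<le> 1 \<or> u @ u \<in> fp_reduced G H)"

lemma segments_ok_Cons:
  "segments_ok ((v, c, u, d) # S) \<longleftrightarrow> set c \<subseteq> letters \<and> set u \<subseteq> letters \<and> set d \<subseteq> letters \<and>
    (length u \<le> 1 \<or> u @ u \<in> fp_reduced G H) \<and> segments_ok S"
  by (auto simp: segments_ok_def)

lemma eval_segment_blocks:
  assumes "segments_ok S"
    and "\<And>v c u d. (v, c, u, d) \<in> set S \<Longrightarrow> \<tau> v = (if hyperbolic u then \<sigma> v else \<sigma>' v)"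
  shows "eval (map (block_letter \<sigma>') (segment_blocks \<sigma> S)) = eval (expand \<tau> S)"
  using assms
proof (induction S)
  case (Cons s S)
  obtain v c u d where s: "s = (v, c, u, d)" by (cases s)
  have c: "set c \<subseteq> letters" "set u \<subseteq> letters" "set d \<subseteq> letters" "segments_ok S"
    "length u \<le> 1 \<or> u @ u \<in> fp_reduced G H"
    using Cons.prems(1) by (auto simp: s segments_ok_Cons)
  have IH: "eval (map (block_letter \<sigma>') (segment_blocks \<sigma> S)) = eval (expand \<tau> S)"
    by (rule Cons.IH[OF c(4) Cons.prems(2)]) (rule list.set_intros(2))
  have "(v, c, u, d) \<in> set (s # S)" by (simp add: s)
  note \<tau> = Cons.prems(2)[OF this]
  have const: "map (block_letter \<sigma>') (map const_block w) = w" if "set w \<subseteq> letters" for w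
    using map_block_letter_const[OF that] by simp
  let ?R = "d @ expand \<tau> S"
  have R: "set ?R \<subseteq> letters" using c(3,4) set_expand[of \<tau> S] by (auto simp: segments_ok_def)
  have tail: "eval (d @ map (block_letter \<sigma>') (segment_blocks \<sigma> S)) = eval ?R"
    using IH by (simp add: eval_append)
  show ?case
  proof (cases "hyperbolic u")
    case True
    have "set (pow_word u (\<sigma> v)) \<subseteq> letters" using c(2) set_pow_word[of u] by blast
    hence "map (block_letter \<sigma>') (segment_blocks \<sigma> (s # S)) =
        (c @ pow_word u (\<sigma> v)) @ d @ map (block_letter \<sigma>') (segment_blocks \<sigma> S)"
      using const c True unfolding s by (simp del: map_map)
    hence "eval (map (block_letter \<sigma>') (segment_blocks \<sigma> (s # S))) = eval ((c @ pow_word u (\<sigma> v)) @ ?R)"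
      by (simp only: eval_append[of "c @ pow_word u (\<sigma> v)"] tail)
    thus ?thesis using \<tau> True by (simp add: s)
  next
    case False
    hence "length u \<le> 1" using c(5) by auto
    have u: "eval (map (block_letter \<sigma>') (map (power_block v) u) @ ?R) = eval (pow_word u (\<tau> v) @ ?R)"
    proof (cases u)
      case (Cons x u')
      hence "u = [x]" using \<open>length u \<le> 1\<close> by simp
      thus ?thesis using push_power_block[OF _ R, of x \<sigma>' v] c(2) \<tau> False by simp
    qed simp
    have "map (block_letter \<sigma>') (segment_blocks \<sigma> (s # S)) =
        c @ map (block_letter \<sigma>') (map (power_block v) u) @ d @
        map (block_letter \<sigma>') (segment_blocks \<sigma> S)"
      using const c False unfolding s by (auto simp del: map_map)
    hence "eval (map (block_letter \<sigma>') (segment_blocks \<sigma> (s # S))) =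
        eval (c @ map (block_letter \<sigma>') (map (power_block v) u) @ ?R)"
      using tail by (simp only: eval_append[of c] eval_append[of "map (block_letter \<sigma>') (map (power_block v) u)"])
    also have "\<dots> = eval (c @ pow_word u (\<tau> v) @ ?R)" using u by (simp only: eval_append[of c])
    finally show ?thesis by (simp add: s)
  qed
qed simp

lemma segment_blocks_closed: "segments_ok S \<Longrightarrow> set (segment_blocks \<sigma> S) \<subseteq> blocks"
proof (induction \<sigma> S rule: segment_blocks.induct)
  case (2 \<sigma> v c u d S)
  hence c: "set c \<subseteq> letters" "set u \<subseteq> letters" "set d \<subseteq> letters" "segments_ok S"
    by (auto simp: segments_ok_Cons)
  have const: "set (map const_block w) \<subseteq> blocks" if "set w \<subseteq> letters" for w
    unfolding set_map by (rule image_subsetI, rule const_block_simps(1)) (use that in blast)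
  have power: "set (map (power_block v) u) \<subseteq> blocks"
    unfolding set_map by (rule image_subsetI, rule power_block_simps(1)) (use c(2) in blast)
  have "set (pow_word u (\<sigma> v)) \<subseteq> letters" using c(2) set_pow_word[of u] by blast
  note const[OF this]
  with "2.IH"[OF c(4)] const[OF c(1)] const[OF c(3)] power show ?case
    by (simp only: segment_blocks.simps set_append Un_subset_iff split: if_splits) simp
qed simp

lemma block_vars_const: "concat (map (block_vars \<circ> const_block) w) = []"
  by (induction w) simp_all

lemma segment_blocks_vars:
  assumes "segments_ok S" "distinct (map fst S)"
  shows "distinct (concat (map block_vars (segment_blocks \<sigma> S))) \<and>
    set (concat (map block_vars (segment_blocks \<sigma> S))) \<subseteq> fst ` set S"
  using assms
proof (induction S)
  case (Cons s S)
  obtain v c u d where s: "s = (v, c, u, d)" by (cases s)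
  let ?vs = "concat (map block_vars (segment_blocks \<sigma> S))"
  have u: "hyperbolic u \<or> length u \<le> 1" and ok: "segments_ok S"
    using Cons.prems(1) by (auto simp: s segments_ok_Cons)
  have IH: "distinct ?vs" "set ?vs \<subseteq> fst ` set S"
    using Cons.IH[OF ok] Cons.prems(2) by auto
  have v: "v \<notin> fst ` set S" using Cons.prems(2) by (simp add: s)
  have "concat (map block_vars (segment_blocks \<sigma> (s # S))) = ?vs \<or>
      concat (map block_vars (segment_blocks \<sigma> (s # S))) = v # ?vs"
  proof (cases "hyperbolic u \<or> u = []")
    case True
    thus ?thesis by (auto simp: s block_vars_const simp del: concat_eq_Nil_conv)
  next
    case False
    then obtain x where "u = [x]" using u by (cases u) auto
    thus ?thesis using False by (auto simp: s block_vars_const simp del: concat_eq_Nil_conv)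
  qed
  thus ?case
  proof
    assume eq: "concat (map block_vars (segment_blocks \<sigma> (s # S))) = ?vs"
    show ?case unfolding eq using IH by auto
  next
    assume eq: "concat (map block_vars (segment_blocks \<sigma> (s # S))) = v # ?vs"
    show ?case unfolding eq using IH v by (auto simp: s)
  qed
qed simp

lemma segment_blocks_size:
  assumes "\<And>v c u d. (v, c, u, d) \<in> set S \<Longrightarrow> hyperbolic u \<Longrightarrow> \<sigma> v \<le> k"
  shows "sum_list (map block_size (segment_blocks \<sigma> S)) \<le> (k + 1) * word_size (symbols S)"
  using assms
proof (induction S)
  case (Cons s S)
  obtain v c u d where s: "s = (v, c, u, d)" by (cases s)
  have const: "sum_list (map block_size (map const_block w)) = word_size w" for w
    by (simp add: word_size_def comp_def)
  have power: "sum_list (map block_size (map (power_block v) u)) = word_size u"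
    by (simp add: word_size_def comp_def)
  have pow: "word_size (pow_word u n) = n * word_size u" for n by (induction n) simp_all
  have IH: "sum_list (map block_size (segment_blocks \<sigma> S)) \<le> (k + 1) * word_size (symbols S)"
    by (rule Cons.IH[OF Cons.prems]) (erule list.set_intros(2), assumption)
  have "sum_list (map block_size (segment_blocks \<sigma> (s # S))) \<le> 
      word_size c + (k + 1) * word_size u + word_size d + sum_list (map block_size (segment_blocks \<sigma> S))"
  proof (cases "hyperbolic u")
    case True
    have "\<sigma> v \<le> k + 1" using Cons.prems[of v c u d] True s by simp
    hence "\<sigma> v * word_size u \<le> (k + 1) * word_size u" by (rule mult_le_mono1)
    thus ?thesis using True const pow unfolding s by (simp del: map_map)
  next
    case False
    thus ?thesis using const power unfolding s by (auto simp del: map_map)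
  qed
  also have "\<dots> \<le> (k + 1) * word_size c + (k + 1) * word_size u + (k + 1) * word_size d +
      (k + 1) * word_size (symbols S)"
    using IH by simp
  also have "\<dots> = (k + 1) * word_size (symbols (s # S))" by (simp add: s algebra_simps)
  finally show ?case .
qed simp

text \<open>
  The hyperbolic exponents of a minimal solution are written out, which gives blocks of total
  size at most \<open>(2 * m + 1) * m\<close>.  The elliptic exponents of this solution are then replaced by
  those that the bounds of the factors provide.
\<close>

lemma bounded_solution:
  assumes ok: "segments_ok S" and dist: "distinct (map fst S)"
    and sol: "eval (expand \<sigma> S) = []" and size: "word_size (symbols S) \<le> m"
  shows "\<exists>\<tau>. eval (expand \<tau> S) = [] \<and>
    (\<forall>v. \<tau> v \<le> 2 * m + exponent_bound ((2 * m + 1) * m))"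
proof -
  have "set (symbols S) \<subseteq> letters" using ok by (simp add: segments_ok_def)
  from bounded_hyperbolic_exponents[OF this dist sol] obtain \<sigma>0
    where \<sigma>0: "eval (expand \<sigma>0 S) = []"
    "\<And>v c u d. (v, c, u, d) \<in> set S \<Longrightarrow> hyperbolic u \<Longrightarrow> \<sigma>0 v \<le> 2 * length (symbols S)" by blast
  have len: "2 * length (symbols S) \<le> 2 * m" using length_le_word_size[of "symbols S"] size by simp
  have hyp: "\<sigma>0 v \<le> 2 * m" if "(v, c, u, d) \<in> set S" "hyperbolic u" for v c u d
    using \<sigma>0(2)[OF that] len by linarith
  let ?T = "segment_blocks \<sigma>0 S"
  have "sum_list (map block_size ?T) \<le> (2 * m + 1) * word_size (symbols S)"
    by (rule segment_blocks_size[OF hyp])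
  also have "\<dots> \<le> (2 * m + 1) * m" using size by (rule mult_le_mono2)
  finally have T: "sum_list (map block_size ?T) \<le> (2 * m + 1) * m" .
  have "eval (map (block_letter \<sigma>0) ?T) = []"
    using eval_segment_blocks[OF ok, of \<sigma>0 \<sigma>0 \<sigma>0] \<sigma>0(1) by simp
  from bounded_blocks[OF segment_blocks_closed[OF ok] _ T this] segment_blocks_vars[OF ok dist]
  obtain \<sigma>' where \<sigma>': "\<And>v. \<sigma>' v \<le> exponent_bound ((2 * m + 1) * m)"
    "eval (map (block_letter \<sigma>') ?T) = []" by blast
  define \<tau> where "\<tau> v = (if \<exists>c u d. (v, c, u, d) \<in> set S \<and> hyperbolic u then \<sigma>0 v else \<sigma>' v)" for v
  have "\<tau> v = (if hyperbolic u then \<sigma>0 v else \<sigma>' v)" if "(v, c, u, d) \<in> set S" for v c u d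
  proof -
    have "u' = u" if "(v, c', u', d') \<in> set S" for c' u' d'
      using eq_key_imp_eq_value[OF dist that \<open>(v, c, u, d) \<in> set S\<close>] by simp
    thus ?thesis using that unfolding \<tau>_def by metis
  qed
  from eval_segment_blocks[OF ok this] have "eval (expand \<tau> S) = []" using \<sigma>'(2) by simp
  moreover have "\<tau> v \<le> 2 * m + exponent_bound ((2 * m + 1) * m)" for v
    using hyp \<sigma>'(1)[of v] by (auto simp: \<tau>_def intro: trans_le_add1 trans_le_add2)
  ultimately show ?thesis by blast
qed

end

section \<open>Knapsack instances in the free product\<close>

context two_normed_knapsack_groups
begin

text \<open>
  The instance becomes an equation with value \<open>1\<close>: one segment for each \<open>g\<^sub>i\<close>, written as a
  conjugate, and a last segment for the inverse of \<open>g\<close>.  Conjugator and core have at most twice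
  the size of \<open>g\<^sub>i\<close> and so has the inverse of the conjugator, whence the factor \<open>4\<close>.
\<close>

lemma bounded_knapsack:
  assumes gs: "set gs \<subseteq> carrier F" and g: "g \<in> carrier F" and KP: "KP F gs g"
    and size: "4 * sum_list (map word_size gs) + word_size g \<le> m"
  shows "BKP F gs g (2 * m + exponent_bound ((2 * m + 1) * m))"
proof -
  interpret F: group F by (rule group_free_product)
  let ?k = "length gs"
  have g_letters: "set g \<subseteq> letters" using g fp_reduced_letters by simp
  have g_inv: "set (inv_word g) \<subseteq> letters" using g_letters by (rule inv_word_closed)
  have "\<forall>h \<in> fp_reduced G H. \<exists>p. set (fst p) \<subseteq> letters \<and> snd p \<in> fp_reduced G H \<and>
      (length (snd p) \<le> 1 \<or> snd p @ snd p \<in> fp_reduced G H) \<and>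
      eval (fst p @ snd p @ inv_word (fst p)) = h \<and> word_size (fst p) + word_size (snd p) \<le> 2 * word_size h"
    using cyclically_reduced_conjugate by (metis fst_conv snd_conv)
  from bchoice[OF this] obtain p where p: "\<And>h. h \<in> fp_reduced G H \<Longrightarrow> set (fst (p h)) \<subseteq> letters \<and>
      snd (p h) \<in> fp_reduced G H \<and> (length (snd (p h)) \<le> 1 \<or> snd (p h) @ snd (p h) \<in> fp_reduced G H) \<and>
      eval (fst (p h) @ snd (p h) @ inv_word (fst (p h))) = h \<and>
      word_size (fst (p h)) + word_size (snd (p h)) \<le> 2 * word_size h" by blast
  define c u where "c i = fst (p (gs ! i))" and "u i = snd (p (gs ! i))" for i
  have cu: "set (c i) \<subseteq> letters" "set (u i) \<subseteq> letters" "length (u i) \<le> 1 \<or> u i @ u i \<in> fp_reduced G H"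
      "eval (c i @ u i @ inv_word (c i)) = gs ! i"
      "word_size (c i) + word_size (u i) \<le> 2 * word_size (gs ! i)" "set (inv_word (c i)) \<subseteq> letters"
    if "i < ?k" for i
  proof -
    have "gs ! i \<in> fp_reduced G H" using gs nth_mem[OF that] by auto
    note * = p[OF this]
    show "set (c i) \<subseteq> letters" "set (u i) \<subseteq> letters" "length (u i) \<le> 1 \<or> u i @ u i \<in> fp_reduced G H"
      "eval (c i @ u i @ inv_word (c i)) = gs ! i"
      "word_size (c i) + word_size (u i) \<le> 2 * word_size (gs ! i)"
      using * fp_reduced_letters by (simp_all add: c_def u_def)
    thus "set (inv_word (c i)) \<subseteq> letters" by (intro inv_word_closed)
  qed
  define seg where "seg i = (i, c i, u i, inv_word (c i))" for i :: nat
  define S where "S = map seg [0..<?k] @ [(?k, inv_word g, [], [])]"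
  have symbols_seg: "set (symbols (map seg ks)) \<subseteq> letters" if "set ks \<subseteq> {..<?k}" for ks
    using that
  proof (induction ks)
    case (Cons i js)
    thus ?case using cu[of i] by (simp add: seg_def)
  qed simp
  have symbols_append: "symbols (A @ B) = symbols A @ symbols B" for A B :: "('a + 'b) segment list"
    by (simp add: symbols_def)
  have "set (symbols S) \<subseteq> letters"
    using symbols_seg[of "[0..<?k]"] g_inv by (simp add: S_def symbols_append atLeast0LessThan)
  moreover have "\<forall>s \<in> set S. case s of (v, c, u, d) \<Rightarrow> length u \<le> 1 \<or> u @ u \<in> fp_reduced G H"
    using cu(3) by (auto simp: S_def seg_def)
  ultimately have ok: "segments_ok S" by (simp add: segments_ok_def)
  have "map fst S = [0..<?k] @ [?k]" by (simp add: S_def seg_def comp_def)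
  hence dist: "distinct (map fst S)" by simp
  have prod: "eval (expand \<tau> (map seg ks)) = list_mult F (map (\<lambda>i. gs ! i [^]\<^bsub>F\<^esub> \<tau> i) ks)"
    if "set ks \<subseteq> {..<?k}" for \<tau> ks
    using that
  proof (induction ks)
    case (Cons i js)
    hence i: "i < ?k" and js: "set js \<subseteq> {..<?k}" by auto
    let ?w = "c i @ pow_word (u i) (\<tau> i) @ inv_word (c i)"
    have pw: "set (pow_word (u i) (\<tau> i)) \<subseteq> letters" using cu(2)[OF i] set_pow_word[of "u i"] by blast
    have w: "set ?w \<subseteq> letters" using cu(1,6)[OF i] pw by simp
    have rest: "set (expand \<tau> (map seg js)) \<subseteq> letters"
      using symbols_seg[OF js] set_expand[of \<tau> "map seg js"] by blast
    have "eval (expand \<tau> (map seg (i # js))) = eval (?w @ expand \<tau> (map seg js))"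
      by (simp add: seg_def)
    also have "\<dots> = eval ?w \<otimes>\<^bsub>F\<^esub> eval (expand \<tau> (map seg js))"
      by (rule eval_append_F[OF w rest])
    also have "eval ?w = gs ! i [^]\<^bsub>F\<^esub> \<tau> i"
      using eval_conjugate_pow[OF cu(1,2)[OF i]] cu(4)[OF i] by simp
    finally show ?case using Cons.IH[OF js] by (simp only: list.map list_mult_simps)
  qed simp
  have knap: "eval (expand \<tau> (map seg [0..<?k])) = knapsack_prod F gs (map \<tau> [0..<?k])" for \<tau>
  proof -
    have "map2 (\<lambda>h e. h [^]\<^bsub>F\<^esub> e) gs (map \<tau> [0..<?k]) = map (\<lambda>i. gs ! i [^]\<^bsub>F\<^esub> \<tau> i) [0..<?k]"
      by (rule nth_equalityI) (simp_all del: free_product_simps)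
    moreover have "set [0..<?k] \<subseteq> {..<?k}" by auto
    ultimately show ?thesis using prod[of "[0..<?k]" \<tau>] by (simp only: knapsack_prod_def)
  qed
  have solution: "eval (expand \<tau> S) = [] \<longleftrightarrow> g = knapsack_prod F gs (map \<tau> [0..<?k])" for \<tau>
  proof -
    let ?K = "knapsack_prod F gs (map \<tau> [0..<?k])"
    have rest: "set (expand \<tau> (map seg [0..<?k])) \<subseteq> letters"
      by (rule subset_trans[OF set_expand symbols_seg]) auto
    have "eval (expand \<tau> S) = eval (expand \<tau> (map seg [0..<?k]) @ inv_word g)"
      by (simp add: S_def expand_append)
    also have "\<dots> = ?K \<otimes>\<^bsub>F\<^esub> inv\<^bsub>F\<^esub> g"
    proof -
      have "eval g = g" using g by (simp add: eval_reduced)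
      thus ?thesis
        unfolding eval_append_F[OF rest g_inv] eval_inv_word[OF g_letters] knap by (rule arg_cong)
    qed
    finally have eq: "eval (expand \<tau> S) = ?K \<otimes>\<^bsub>F\<^esub> inv\<^bsub>F\<^esub> g" .
    have K: "?K \<in> carrier F" using eval_closed_F[OF rest] by (simp only: knap)
    have "?K \<otimes>\<^bsub>F\<^esub> inv\<^bsub>F\<^esub> g = \<one>\<^bsub>F\<^esub> \<longleftrightarrow> g = ?K"
    proof
      assume "?K \<otimes>\<^bsub>F\<^esub> inv\<^bsub>F\<^esub> g = \<one>\<^bsub>F\<^esub>"
      from F.inv_equality[OF this F.inv_closed[OF g] K] show "g = ?K" unfolding F.inv_inv[OF g] .
    next
      assume "g = ?K"
      from F.r_inv[OF g] show "?K \<otimes>\<^bsub>F\<^esub> inv\<^bsub>F\<^esub> g = \<one>\<^bsub>F\<^esub>"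
        unfolding \<open>g = ?K\<close>[symmetric] .
    qed
    thus ?thesis using eq by (simp only: free_product_simps(3))
  qed
  from KP obtain es where es: "length es = ?k" "g = knapsack_prod F gs es" unfolding KP_def by blast
  have "map (nth es) [0..<?k] = es" using map_nth[of es] es(1) by simp
  hence sol: "eval (expand (nth es) S) = []" using solution[of "nth es"] es(2) by simp
  have "word_size (symbols (map seg ks)) \<le> sum_list (map (\<lambda>i. 4 * word_size (gs ! i)) ks)"
    if "set ks \<subseteq> {..<?k}" for ks
    using that
  proof (induction ks)
    case (Cons i js)
    thus ?case using cu(5)[of i] word_size_inv[OF cu(1), of i] by (simp add: seg_def)
  qed simp
  from this[of "[0..<?k]"]
  have "word_size (symbols (map seg [0..<?k])) \<le> (\<Sum>i\<leftarrow>[0..<?k]. 4 * word_size (gs ! i))"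
    by (simp add: atLeast0LessThan)
  also have "\<dots> = 4 * sum_list (map (\<lambda>i. word_size (gs ! i)) [0..<?k])"
    by (simp add: sum_list_const_mult)
  also have "map (\<lambda>i. word_size (gs ! i)) [0..<?k] = map word_size gs"
    by (rule nth_equalityI) simp_all
  finally have "word_size (symbols S) \<le> m"
    using size word_size_inv[OF g_letters] by (simp add: S_def symbols_append)
  from bounded_solution[OF ok dist sol this] obtain \<tau>
    where \<tau>: "eval (expand \<tau> S) = []" "\<And>v. \<tau> v \<le> 2 * m + exponent_bound ((2 * m + 1) * m)" by blast
  show ?thesis unfolding BKP_def
  proof (intro exI[of _ "map \<tau> [0..<?k]"] conjI)
    show "g = knapsack_prod F gs (map \<tau> [0..<?k])" using solution \<tau>(1) by blast
  qed (use \<tau>(2) in auto)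
qed

lemma fp_inl_group_hom: "group_hom G F (fp_inl G H)"
  by (intro group_hom.intro group_hom_axioms.intro G.is_group group_free_product fp_inl_hom)

lemma fp_inr_group_hom: "group_hom H F (fp_inr G H)"
  by (intro group_hom.intro group_hom_axioms.intro H.is_group group_free_product fp_inr_hom)

lemma free_product_generated:
  assumes X: "finite_gen_set G X" and Y: "finite_gen_set H Y"
  shows "finite_gen_set F (fp_inl G H ` X \<union> fp_inr G H ` Y)"
proof -
  interpret F: group F by (rule group_free_product)
  interpret l: group_hom G F "fp_inl G H" by (rule fp_inl_group_hom)
  interpret r: group_hom H F "fp_inr G H" by (rule fp_inr_group_hom)
  let ?Z = "fp_inl G H ` X \<union> fp_inr G H ` Y"
  have XY: "finite X" "X \<subseteq> carrier G" "generate G X = carrier G"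
    "finite Y" "Y \<subseteq> carrier H" "generate H Y = carrier H"
    using X Y by (simp_all add: finite_gen_set_def)
  have Z: "?Z \<subseteq> carrier F" using XY l.hom_closed r.hom_closed by auto
  have single: "[x] \<in> generate F ?Z" if x: "x \<in> nontrivial" for x
  proof (cases x)
    case (Inl a)
    have a: "a \<in> carrier G" "[x] = fp_inl G H a" using x Inl by (auto simp: fp_letters_def fp_inl_def)
    have "fp_inl G H a \<in> fp_inl G H ` generate G X" using a(1) by (simp only: XY(3) imageI)
    also have "\<dots> = generate F (fp_inl G H ` X)" using l.generate_img[OF XY(2)] by simp
    also have "\<dots> \<subseteq> generate F ?Z" by (rule F.mono_generate) simp
    finally show ?thesis by (simp only: a(2))
  next
    case (Inr b)
    have b: "b \<in> carrier H" "[x] = fp_inr G H b" using x Inr by (auto simp: fp_letters_def fp_inr_def)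
    have "fp_inr G H b \<in> fp_inr G H ` generate H Y" using b(1) by (simp only: XY(6) imageI)
    also have "\<dots> = generate F (fp_inr G H ` Y)" using r.generate_img[OF XY(5)] by simp
    also have "\<dots> \<subseteq> generate F ?Z" by (rule F.mono_generate) simp
    finally show ?thesis by (simp only: b(2))
  qed
  have "w \<in> generate F ?Z" if "w \<in> fp_reduced G H" for w
    using that
  proof (induction w)
    case Nil
    show ?case using generate.one[of F ?Z] by simp
  next
    case (Cons x w)
    hence x: "x \<in> nontrivial" "w \<in> fp_reduced G H" by (auto simp: Cons_fp_reduced_iff)
    have "x # w = [x] \<otimes>\<^bsub>F\<^esub> w"
      using eval_reduced[OF Cons.prems] eval_reduced[OF x(2)] by simp
    thus ?case using generate.eng[OF single[OF x(1)] Cons.IH[OF x(2)]] by (simp only:)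
  qed
  hence "carrier F \<subseteq> generate F ?Z" by auto
  hence "generate F ?Z = carrier F" using F.generate_incl[OF Z] by blast
  thus ?thesis using XY(1,4) Z by (simp only: finite_gen_set_def finite_Un finite_imageI)
qed

lemma generator_word_size:
  assumes X: "X \<subseteq> carrier G" "\<And>x. x \<in> X \<union> m_inv G ` X \<Longrightarrow> nu x \<le> 1"
    and Y: "Y \<subseteq> carrier H" "\<And>y. y \<in> Y \<union> m_inv H ` Y \<Longrightarrow> nu' y \<le> 1"
    and w: "w \<in> group_words F (fp_inl G H ` X \<union> fp_inr G H ` Y)"
  shows "word_size (list_mult F w) \<le> 2 * length w \<and> list_mult F w \<in> carrier F"
proof -
  interpret l: group_hom G F "fp_inl G H" by (rule fp_inl_group_hom)
  interpret r: group_hom H F "fp_inr G H" by (rule fp_inr_group_hom)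
  let ?Z = "fp_inl G H ` X \<union> fp_inr G H ` Y"
  have inl: "word_size (fp_inl G H x) \<le> 2" if "nu x \<le> 1" for x
    using that by (simp add: fp_inl_def letter_size_def)
  have inr: "word_size (fp_inr G H y) \<le> 2" if "nu' y \<le> 1" for y
    using that by (simp add: fp_inr_def letter_size_def)
  have gen: "word_size z \<le> 2 \<and> z \<in> fp_reduced G H" if z: "z \<in> ?Z \<union> m_inv F ` ?Z" for z
  proof -
    from z consider x where "x \<in> X" "z = fp_inl G H x" | x where "x \<in> X" "z = inv\<^bsub>F\<^esub> (fp_inl G H x)"
      | y where "y \<in> Y" "z = fp_inr G H y" | y where "y \<in> Y" "z = inv\<^bsub>F\<^esub> (fp_inr G H y)" by blast
    hence "(\<exists>x \<in> carrier G. nu x \<le> 1 \<and> z = fp_inl G H x) \<or> (\<exists>y \<in> carrier H. nu' y \<le> 1 \<and> z = fp_inr G H y)"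
    proof cases
      case 1
      thus ?thesis using X by blast
    next
      case 2
      hence "x \<in> carrier G" using X(1) by blast
      from l.hom_inv[OF this] G.inv_closed[OF this] show ?thesis using X(2)[of "inv\<^bsub>G\<^esub> x"] 2 by auto
    next
      case 3
      thus ?thesis using Y by blast
    next
      case 4
      hence "y \<in> carrier H" using Y(1) by blast
      from r.hom_inv[OF this] H.inv_closed[OF this] show ?thesis using Y(2)[of "inv\<^bsub>H\<^esub> y"] 4 by auto
    qed
    thus ?thesis using inl inr l.hom_closed r.hom_closed by auto
  qed
  have "set w \<subseteq> ?Z \<union> m_inv F ` ?Z" using w by (auto simp: group_words_def)
  thus ?thesis
  proof (induction w)
    case (Cons z w)
    let ?v = "list_mult F w"
    have z: "word_size z \<le> 2" "set z \<subseteq> letters" "z \<in> fp_reduced G H"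
      using gen[of z] Cons.prems fp_reduced_letters by auto
    have v: "word_size ?v \<le> 2 * length w" "?v \<in> carrier F" using Cons by auto
    have v_letters: "set ?v \<subseteq> letters" using v(2) fp_reduced_letters by simp
    have "list_mult F (z # w) = eval (z @ ?v)"
      using eval_append_mult[OF z(2) v_letters] eval_reduced z(3) v(2) by simp
    moreover have "set (z @ ?v) \<subseteq> letters" using z(2) v_letters by simp
    ultimately show ?case
      using word_size_eval[of "z @ ?v"] z(1) v(1) eval_closed_F[of "z @ ?v"] by simp
  qed simp
qed

end

theorem proposition10:
  fixes G :: "('a, 'm) monoid_scheme" and H :: "('b, 'n) monoid_scheme"
  assumes "poly_bounded_knapsack_group G" and "poly_bounded_knapsack_group H"
  shows "poly_bounded_knapsack_group (free_product G H)"
proof -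
  obtain X nu r where X: "finite_gen_set G X" "\<And>x. x \<in> X \<union> m_inv G ` X \<Longrightarrow> nu x \<le> 1"
    and r: "\<And>n::int. n \<ge> 0 \<Longrightarrow> poly r n > 0"
    and G: "normed_knapsack_group G nu (\<lambda>n. nat (poly r (int n)))"
    using poly_bounded_knapsack_group_norm[OF assms(1)] by metis
  obtain Y nu' r' where Y: "finite_gen_set H Y" "\<And>x. x \<in> Y \<union> m_inv H ` Y \<Longrightarrow> nu' x \<le> 1"
    and r': "\<And>n::int. n \<ge> 0 \<Longrightarrow> poly r' n > 0"
    and H: "normed_knapsack_group H nu' (\<lambda>n. nat (poly r' (int n)))"
    using poly_bounded_knapsack_group_norm[OF assms(2)] by metis
  have groups: "two_groups G H"
    using G H by (simp add: two_groups_def normed_knapsack_group_def)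
  interpret two_normed_knapsack_groups G H nu "\<lambda>n. nat (poly r (int n))" nu' "\<lambda>n. nat (poly r' (int n))"
    by (intro two_normed_knapsack_groups.intro groups G H)
  let ?F = "free_product G H"
  let ?Z = "fp_inl G H ` X \<union> fp_inr G H ` Y"
  have XY: "X \<subseteq> carrier G" "Y \<subseteq> carrier H" using X Y by (auto simp: finite_gen_set_def)
  \<comment> \<open>A generator has size at most \<open>2\<close>, so an instance of length \<open>N\<close> gives an equation of size
    at most \<open>8 * N\<close>, and the polynomial \<open>M\<close> gives the bound \<open>(2 * (8 * N) + 1) * (8 * N)\<close> for its blocks.\<close>
  define M where "M = [:0, 8, 128 :: int:]"
  define q where "q = [:1, 16:] + pcompose (r + r') (([:1:] + [:2:] * M) * M)"
  have q: "poly q (int N) > 0"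
    "2 * (8 * N) + exponent_bound ((2 * (8 * N) + 1) * (8 * N)) \<le> nat (poly q (int N))" for N
  proof -
    define k where "k = (2 * (8 * N) + 1) * (8 * N)"
    define l where "l = (2 * k + 1) * k"
    have "poly M (int N) = int k" by (simp add: M_def k_def algebra_simps)
    hence "poly (([:1:] + [:2:] * M) * M) (int N) = int l" by (simp add: l_def algebra_simps)
    hence eq: "poly q (int N) = 1 + 16 * int N + poly r (int l) + poly r' (int l)"
      unfolding q_def poly_add poly_pcompose by simp
    have "0 < poly r (int l)" "0 < poly r' (int l)" using r r' by simp_all
    thus "poly q (int N) > 0"
      "2 * (8 * N) + exponent_bound ((2 * (8 * N) + 1) * (8 * N)) \<le> nat (poly q (int N))"
      unfolding exponent_bound_def k_def[symmetric] l_def[symmetric] eq by simp_all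
  qed
  have "knapsack_bounded_by ?F ?Z q"
    unfolding knapsack_bounded_by_def Let_def
  proof (intro conjI allI impI)
    show "poly q (int n) > 0" for n by (rule q(1))
  next
    fix ws w assume ws: "set ws \<subseteq> group_words ?F ?Z \<and> w \<in> group_words ?F ?Z"
    let ?gs = "map (list_mult ?F) ws" and ?g = "list_mult ?F w"
    let ?N = "sum_list (map length ws) + length w"
    note words = generator_word_size[OF XY(1) X(2) XY(2) Y(2)]
    show "KP ?F ?gs ?g \<longleftrightarrow> BKP ?F ?gs ?g (nat (poly q (int ?N)))"
    proof
      assume KP: "KP ?F ?gs ?g"
      have "set ws \<subseteq> group_words ?F ?Z" using ws ..
      hence "sum_list (map word_size ?gs) \<le> 2 * sum_list (map length ws) \<and> set ?gs \<subseteq> carrier ?F"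
      proof (induction ws)
        case (Cons v ws)
        thus ?case using words[of v] by auto
      qed simp
      hence gs: "sum_list (map word_size ?gs) \<le> 2 * sum_list (map length ws)" "set ?gs \<subseteq> carrier ?F"
        by blast+
      have g: "word_size ?g \<le> 2 * length w" "?g \<in> carrier ?F" using words ws by blast+
      have "BKP ?F ?gs ?g (2 * (8 * ?N) + exponent_bound ((2 * (8 * ?N) + 1) * (8 * ?N)))"
      proof (rule bounded_knapsack[OF gs(2) g(2) KP])
        have "4 * a + b \<le> 8 * (c + d)" if "a \<le> 2 * c" "b \<le> 2 * d" for a b c d :: nat
          using that by simp
        from this[OF gs(1) g(1)]
        show "4 * sum_list (map word_size ?gs) + word_size ?g \<le> 8 * ?N" .
      qed
      from this q(2) show "BKP ?F ?gs ?g (nat (poly q (int ?N)))" by (rule BKP_mono)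
    qed (rule BKP_imp_KP)
  qed
  thus ?thesis unfolding poly_bounded_knapsack_group_def
    using group_free_product free_product_generated[OF X(1) Y(1)] by blast
qed

end
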